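(* There exists an automaton group $G$ whose order problem is undecidable; that is, there is an automaton group $G$ with a finite generating set $S$ closed under inverses such that there is no algorithm which, given a word $w\in S^*$, decides whether $w$ represents an element of finite order in $G$.
   Context: A Mealy automaton is a tuple $(A,\Sigma,\delta,\sigma)$ where $A$ (the states) and $\Sigma$ (the alphabet) are finite sets, and $\delta\colon A\times\Sigma\to A$, $\sigma\colon A\times\Sigma\to\Sigma$ are maps. For $p\in A$ let $\sigma_p\colon\Sigma^*\to\Sigma^*$ be the length-preserving map defined recursively by $\sigma_p(\text{empty word})=\text{empty word}$ and $\sigma_p(xy)=\sigma(p,x)\,\sigma_{\delta(p,x)}(y)$ for $x\in\Sigma$, $y\in\Sigma^*$. If all $\sigma_p$ ($p\in A$) are bijective, the group generated by the automaton is the subgroup of $\mathrm{Aut}(\Sigma^* )$ generated by all $\sigma_p$, $p\in A$. An automaton group is a group generated by a Mealy automaton. $S^*$ denotes the set of finite words over $S$. The decidability of the order problem does not depend on the choice of the finite generating set. *)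

theory Defs
  imports "HOL-Algebra.Algebra" "HOL-Library.Sublist" "HOL-Library.Nat_Bijection"
begin

section \<open>Algorithms: partial recursive functions\<close>

text \<open>Arities are not tracked in the syntax. A program evaluated on an argument list for which no
  rule applies has no value.\<close>

datatype recf =
    Zero
  | Succ
  | Proj nat
  | Comp recf "recf list"
  | PrimRec recf recf
  | Mu recf

inductive rec_eval :: "recf \<Rightarrow> nat list \<Rightarrow> nat \<Rightarrow> bool" where
  eval_Zero: "rec_eval Zero xs 0"
| eval_Succ: "rec_eval Succ [x] (Suc x)"
| eval_Proj: "i < length xs \<Longrightarrow> rec_eval (Proj i) xs (xs ! i)"
| eval_Comp: "list_all2 (\<lambda>g y. rec_eval g xs y) gs ys \<Longrightarrow> rec_eval f ys z \<Longrightarrow> rec_eval (Comp f gs) xs z"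
| eval_PrimRec_0: "rec_eval f xs z \<Longrightarrow> rec_eval (PrimRec f g) (0 # xs) z"
| eval_PrimRec_Suc:
    "rec_eval (PrimRec f g) (n # xs) y \<Longrightarrow> rec_eval g (n # y # xs) z \<Longrightarrow>
     rec_eval (PrimRec f g) (Suc n # xs) z"
| eval_Mu:
    "rec_eval f (n # xs) 0 \<Longrightarrow> (\<forall>m<n. \<exists>y>0. rec_eval f (m # xs) y) \<Longrightarrow> rec_eval (Mu f) xs n"

lemma rec_eval_deterministic: "rec_eval f xs y \<Longrightarrow> rec_eval f xs z \<Longrightarrow> y = z"
proof (induction arbitrary: z rule: rec_eval.induct)
  case eval_Zero
  then show ?case by cases simp
next
  case eval_Succ
  then show ?case by cases simp
next
  case eval_Proj
  from eval_Proj.prems show ?case by cases simp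
next
  case (eval_Comp xs gs ys f w)
  from eval_Comp.prems obtain ys' where
    ys': "list_all2 (\<lambda>g y. rec_eval g xs y) gs ys'" "rec_eval f ys' z"
    by cases
  have "ys = ys'"
  proof (rule nth_equalityI)
    show "length ys = length ys'"
      using eval_Comp.IH(1) ys'(1) by (simp add: list_all2_conv_all_nth)
    show "ys ! i = ys' ! i" if "i < length ys" for i
      using eval_Comp.IH(1) ys'(1) that by (simp add: list_all2_conv_all_nth)
  qed
  with ys'(2) eval_Comp.IH(2) show ?case by blast
next
  case (eval_PrimRec_0 f xs w g)
  from eval_PrimRec_0.prems show ?case by cases (blast intro: eval_PrimRec_0.IH)
next
  case (eval_PrimRec_Suc f g n xs y w)
  from eval_PrimRec_Suc.prems obtain y' where
    y': "rec_eval (PrimRec f g) (n # xs) y'" "rec_eval g (n # y' # xs) z"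
    by cases
  have "y = y'" using eval_PrimRec_Suc.IH(1) y'(1) .
  with eval_PrimRec_Suc.IH(2) y'(2) show ?case by simp
next
  case (eval_Mu f n xs)
  from eval_Mu.prems have z: "rec_eval f (z # xs) 0" "\<forall>m<z. \<exists>y>0. rec_eval f (m # xs) y"
    by (cases, blast)+
  show ?case
  proof (rule linorder_cases[of n z])
    assume "n < z"
    then obtain y where "y > 0" "rec_eval f (n # xs) y" using z(2) by blast
    with eval_Mu.IH(1) show ?thesis by fastforce
  next
    assume "z < n"
    then obtain y where "y > 0" "\<forall>x. rec_eval f (z # xs) x \<longrightarrow> y = x" using eval_Mu.IH(2) by blast
    with z(1) show ?thesis by fastforce
  qed
qed

text \<open>Words over a finite alphabet \<open>S\<close> are presented to a program as a single number, by
  numbering the letters and then applying the computable bijection \<^const>\<open>list_encode\<close>. Two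
  numberings of \<open>S\<close> differ by a permutation of finitely many numbers, so the choice of \<open>e\<close>
  is immaterial. The program is only required to halt on codes of words over \<open>S\<close>.\<close>

definition decidable_language :: "'a set \<Rightarrow> 'a list set \<Rightarrow> bool" where
  "decidable_language S L \<longleftrightarrow>
     (\<exists>e f. bij_betw e S {..<card S} \<and>
        (\<forall>w\<in>lists S. rec_eval f [list_encode (map e w)] (if w \<in> L then 1 else 0)))"


section \<open>Automaton groups\<close>

record ('q, 'a) mealy =
  states :: "'q set"
  alphabet :: "'a set"
  transition :: "'q \<Rightarrow> 'a \<Rightarrow> 'q"
  emit :: "'q \<Rightarrow> 'a \<Rightarrow> 'a"

definition mealy_automaton :: "('q, 'a) mealy \<Rightarrow> bool" where
  "mealy_automaton M \<longleftrightarrow>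
     finite (states M) \<and> finite (alphabet M) \<and>
     (\<forall>p\<in>states M. \<forall>x\<in>alphabet M. transition M p x \<in> states M \<and> emit M p x \<in> alphabet M)"

fun run :: "('q, 'a) mealy \<Rightarrow> 'q \<Rightarrow> 'a list \<Rightarrow> 'a list" where
  "run M p [] = []"
| "run M p (x # y) = emit M p x # run M (transition M p x) y"

definition invertible_automaton :: "('q, 'a) mealy \<Rightarrow> bool" where
  "invertible_automaton M \<longleftrightarrow>
     (\<forall>p\<in>states M. bij_betw (run M p) (lists (alphabet M)) (lists (alphabet M)))"

text \<open>Automorphisms of the rooted tree of words over \<open>\<Sigma>\<close>. As in \<^const>\<open>BijGroup\<close>, they are
  extensional functions, and \<open>g \<otimes> f\<close> is the map applying \<open>f\<close> first.\<close>

definition tree_Aut :: "'a set \<Rightarrow> ('a list \<Rightarrow> 'a list) monoid" where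
  "tree_Aut \<Sigma> = (BijGroup (lists \<Sigma>))
     \<lparr>carrier := {f \<in> Bij (lists \<Sigma>). \<forall>u\<in>lists \<Sigma>. \<forall>v\<in>lists \<Sigma>. prefix (f u) (f v) \<longleftrightarrow> prefix u v}\<rparr>"

definition state_maps :: "('q, 'a) mealy \<Rightarrow> ('a list \<Rightarrow> 'a list) set" where
  "state_maps M = (\<lambda>p. restrict (run M p) (lists (alphabet M))) ` states M"

definition generated_group :: "('q, 'a) mealy \<Rightarrow> ('a list \<Rightarrow> 'a list) monoid" where
  "generated_group M =
     (tree_Aut (alphabet M))\<lparr>carrier := generate (tree_Aut (alphabet M)) (state_maps M)\<rparr>"

text \<open>States and letters are taken to be natural numbers; since both sets are finite, this loses
  nothing up to renaming.\<close>

definition automaton_group :: "(nat list \<Rightarrow> nat list) monoid \<Rightarrow> bool" where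
  "automaton_group G \<longleftrightarrow>
     (\<exists>M :: (nat, nat) mealy.
        mealy_automaton M \<and> invertible_automaton M \<and> G = generated_group M)"

lemma tree_Aut_group: "group (tree_Aut \<Sigma>)"
proof -
  interpret B: group "BijGroup (lists \<Sigma>)" by (rule group_BijGroup)
  let ?H = "{f \<in> Bij (lists \<Sigma>). \<forall>u\<in>lists \<Sigma>. \<forall>v\<in>lists \<Sigma>. prefix (f u) (f v) \<longleftrightarrow> prefix u v}"
  have "subgroup ?H (BijGroup (lists \<Sigma>))"
  proof
    show "?H \<subseteq> carrier (BijGroup (lists \<Sigma>))" by (auto simp: BijGroup_def)
  next
    fix f g assume fg: "f \<in> ?H" "g \<in> ?H"
    then have Bij: "f \<in> Bij (lists \<Sigma>)" "g \<in> Bij (lists \<Sigma>)" by simp_all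
    have g: "g u \<in> lists \<Sigma>" if "u \<in> lists \<Sigma>" for u
      using Bij_imp_funcset[OF Bij(2)] that by (rule funcset_mem)
    have "prefix (f (g u)) (f (g v)) \<longleftrightarrow> prefix u v" if "u \<in> lists \<Sigma>" "v \<in> lists \<Sigma>" for u v
      using fg g[OF that(1)] g[OF that(2)] that by blast
    with Bij show "f \<otimes>\<^bsub>BijGroup (lists \<Sigma>)\<^esub> g \<in> ?H"
      by (simp add: BijGroup_def compose_Bij compose_eq del: in_lists_conv_set)
  next
    show "\<one>\<^bsub>BijGroup (lists \<Sigma>)\<^esub> \<in> ?H" by (auto simp: BijGroup_def id_Bij)
  next
    fix f assume f: "f \<in> ?H"
    let ?g = "inv_into (lists \<Sigma>) f"
    have im: "f ` lists \<Sigma> = lists \<Sigma>" using f by (auto simp: Bij_def bij_betw_def)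
    have g: "?g u \<in> lists \<Sigma>" "f (?g u) = u" if "u \<in> lists \<Sigma>" for u
      using that im by (metis inv_into_into, metis f_inv_into_f)
    have "prefix (?g u) (?g v) \<longleftrightarrow> prefix (f (?g u)) (f (?g v))"
      if "u \<in> lists \<Sigma>" "v \<in> lists \<Sigma>" for u v
      using f g(1)[OF that(1)] g(1)[OF that(2)] by blast
    then have "prefix (?g u) (?g v) \<longleftrightarrow> prefix u v" if "u \<in> lists \<Sigma>" "v \<in> lists \<Sigma>" for u v
      using that g(2) by metis
    with f show "inv\<^bsub>BijGroup (lists \<Sigma>)\<^esub> f \<in> ?H"
      by (simp add: inv_BijGroup restrict_inv_into_Bij del: in_lists_conv_set)
  qed
  from B.subgroup_imp_group[OF this] show ?thesis
    by (simp add: tree_Aut_def)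
qed

lemma length_run [simp]: "length (run M p w) = length w"
  by (induction w arbitrary: p) auto

lemma prefix_run: "prefix u v \<Longrightarrow> prefix (run M p u) (run M p v)"
proof (induction u arbitrary: p v)
  case (Cons x u)
  then show ?case by (cases v) auto
qed simp

lemma state_maps_subset:
  assumes "invertible_automaton M"
  shows "state_maps M \<subseteq> carrier (tree_Aut (alphabet M))"
proof (clarsimp simp: state_maps_def)
  fix p assume p: "p \<in> states M"
  let ?W = "lists (alphabet M)"
  have bij: "bij_betw (run M p) ?W ?W" using assms p by (simp add: invertible_automaton_def)
  have "prefix u v" if uv: "u \<in> ?W" "v \<in> ?W" and pre: "prefix (run M p u) (run M p v)" for u v
  proof -
    have le: "length u \<le> length v" using prefix_length_le[OF pre] by simp
    have tk: "take (length u) v \<in> ?W" using uv(2) by (auto dest: in_set_takeD)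
    have "prefix (run M p (take (length u) v)) (run M p v)"
      by (rule prefix_run) (rule take_is_prefix)
    with pre le have "run M p (take (length u) v) = run M p u"
      by (auto simp: prefix_def append_eq_append_conv)
    with bij uv(1) tk have "take (length u) v = u" by (auto simp: bij_betw_def dest: inj_onD)
    then show ?thesis using take_is_prefix by metis
  qed
  with bij show "restrict (run M p) ?W \<in> carrier (tree_Aut (alphabet M))"
    by (auto simp: tree_Aut_def Bij_def intro: prefix_run)
qed


section \<open>The order problem\<close>

definition word_value :: "('g, 'b) monoid_scheme \<Rightarrow> 'g list \<Rightarrow> 'g" where
  "word_value G w = foldr (\<lambda>s g. s \<otimes>\<^bsub>G\<^esub> g) w \<one>\<^bsub>G\<^esub>"

definition finite_order :: "('g, 'b) monoid_scheme \<Rightarrow> 'g \<Rightarrow> bool" where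
  "finite_order G g \<longleftrightarrow> (\<exists>n::nat. n > 0 \<and> g [^]\<^bsub>G\<^esub> n = \<one>\<^bsub>G\<^esub>)"

definition order_problem_decidable :: "('g, 'b) monoid_scheme \<Rightarrow> 'g set \<Rightarrow> bool" where
  "order_problem_decidable G S \<longleftrightarrow>
     decidable_language S {w \<in> lists S. finite_order G (word_value G w)}"

end

theory Submission
  imports Defs "HOL-Library.Countable"
begin

text \<open>
  The generators are two involutions \<open>s\<close>, \<open>u\<close> and commuting odometers \<open>t\<^sub>0, t\<^sub>1, \<dots>\<close>. A tuple
  \<open>n\<close> of counters is represented by \<open>g(n) = F u F\<inverse> s\<close>, where \<open>F = t\<^sub>0\<^bsup>n\<^sub>0\<^esup> t\<^sub>1\<^bsup>n\<^sub>1\<^esup> \<cdots>\<close>. On the first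
  letter the odometers count modulo \<open>k\<close>, so \<open>g(n)\<close> moves far only on letters attached to the
  residues of \<open>n\<close>: there \<open>s\<close> and the conjugate of \<open>u\<close> act as the two reflections of a path with
  \<open>2 p + 1\<close> nodes, hence \<open>g(n)\<close> runs through the whole path, and its first return
  \<open>g(n)\<^bsup>2p+1\<^esup>\<close> acts below as \<open>g(n')\<close>, where \<open>n'\<close> is obtained from \<open>n\<close> by a piecewise affine map
  that depends on the residues. On all other letters \<open>g(n)\<close> acts with order at most two. So
  \<open>g(n)\<close> and \<open>g(n')\<close> both have finite order or both have infinite order, a configuration without
  successor has finite order, and a configuration with \<open>n' = n\<close> has infinite order, because passing
  to the return divides a finite order by \<open>2 p + 1\<close>.

  Writing stacks as numbers in base \<open>k\<close>, such maps perform the steps of a machine with several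
  stacks. One fixed machine of this kind interprets programs that are part of its input, and
  recursive functions compile to such programs. For a hypothetical decision procedure \<open>d\<close>, the
  machine run on the program of \<open>n \<mapsto> d (word of n)\<close> with its own index as input halts if \<open>d\<close>
  answers ``infinite order'' and ends in a loop if \<open>d\<close> answers ``finite order''.
\<close>

section \<open>Automata and their groups\<close>

text \<open>The rightmost state acts first, in agreement with \<open>word_value\<close> and with the
  product of \<open>tree_Aut\<close>.\<close>

definition run_word :: "('q, 'a) mealy \<Rightarrow> 'q list \<Rightarrow> 'a list \<Rightarrow> 'a list" where
  "run_word M ps = foldr (\<lambda>p f. run M p \<circ> f) ps id"

lemma run_word_simps [simp]:
  "run_word M [] v = v"
  "run_word M (p # ps) v = run M p (run_word M ps v)"
  "run_word M (ps @ qs) v = run_word M ps (run_word M qs v)"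
  by (simp_all add: run_word_def) (induction ps, simp_all)

lemma run_word_Cons: "run_word M (p # ps) = run M p \<circ> run_word M ps"
  by (simp add: run_word_def)

lemma bij_betw_run_word:
  assumes "invertible_automaton M" "ps \<in> lists (states M)"
  shows "bij_betw (run_word M ps) (lists (alphabet M)) (lists (alphabet M))"
  using assms(2)
proof (induction ps)
  case Nil
  then show ?case by (simp add: run_word_def bij_betw_def)
next
  case (Cons p ps)
  have "bij_betw (run M p \<circ> run_word M ps) (lists (alphabet M)) (lists (alphabet M))"
    using Cons assms(1) by (intro bij_betw_trans) (auto simp: invertible_automaton_def)
  then show ?case by (simp only: run_word_Cons)
qed

lemma group_generated_group:
  assumes "invertible_automaton M"
  shows "group (generated_group M)"
  unfolding generated_group_def
  using group.subgroup_imp_group[OF tree_Aut_group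
      group.generate_is_subgroup[OF tree_Aut_group state_maps_subset[OF assms]]] .

text \<open>The carrier is generated inside the group of all tree automorphisms, and generation is
  the same in any subgroup containing the generators.\<close>

lemma generate_state_maps:
  assumes "invertible_automaton M"
  shows "generate (generated_group M) (state_maps M) = carrier (generated_group M)"
proof -
  have "state_maps M \<subseteq> generate (tree_Aut (alphabet M)) (state_maps M)"
    by (auto intro: generate.incl)
  from group.generate_consistent[OF tree_Aut_group this
      group.generate_is_subgroup[OF tree_Aut_group state_maps_subset[OF assms]]]
  show ?thesis by (simp add: generated_group_def)
qed

lemma mult_generated_group:
  assumes "bij_betw f (lists (alphabet M)) (lists (alphabet M))"
    and "bij_betw g (lists (alphabet M)) (lists (alphabet M))"
  shows "restrict f (lists (alphabet M)) \<otimes>\<^bsub>generated_group M\<^esub> restrict g (lists (alphabet M)) =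
    restrict (f \<circ> g) (lists (alphabet M))"
proof -
  have "restrict f (lists (alphabet M)) \<in> Bij (lists (alphabet M))"
    "restrict g (lists (alphabet M)) \<in> Bij (lists (alphabet M))"
    using assms by (simp_all add: Bij_def del: in_lists_conv_set)
  moreover have "g v \<in> lists (alphabet M)" if "v \<in> lists (alphabet M)" for v
    using assms(2) that by (rule bij_betw_apply)
  ultimately show ?thesis
    by (auto simp: generated_group_def tree_Aut_def BijGroup_def compose_def restrict_def
        simp del: in_lists_conv_set)
qed

lemma one_generated_group: "\<one>\<^bsub>generated_group M\<^esub> = restrict id (lists (alphabet M))"
  by (simp add: generated_group_def tree_Aut_def BijGroup_def restrict_def id_def)

lemma word_value_Cons: "word_value G (a # as) = a \<otimes>\<^bsub>G\<^esub> word_value G as"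
  by (simp add: word_value_def)

lemma word_value_generated_group:
  assumes "invertible_automaton M" "ps \<in> lists (states M)"
  shows "word_value (generated_group M) (map (\<lambda>p. restrict (run M p) (lists (alphabet M))) ps) =
    restrict (run_word M ps) (lists (alphabet M))"
  using assms(2)
proof (induction ps)
  case Nil
  then show ?case by (simp add: word_value_def one_generated_group run_word_def id_def)
next
  case (Cons p ps)
  have "bij_betw (run M p) (lists (alphabet M)) (lists (alphabet M))"
    using assms(1) Cons by (auto simp: invertible_automaton_def)
  from mult_generated_group[OF this bij_betw_run_word[OF assms(1) Cons.hyps(2)]] Cons.IH
  show ?case by (simp only: word_value_Cons run_word_Cons list.map)
qed

lemma finite_order_generated_group:
  assumes "bij_betw f (lists (alphabet M)) (lists (alphabet M))"
  shows "finite_order (generated_group M) (restrict f (lists (alphabet M))) \<longleftrightarrow>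
    (\<exists>n>0. \<forall>v\<in>lists (alphabet M). (f ^^ n) v = v)"
proof -
  let ?L = "lists (alphabet M)"
  have "restrict f ?L [^]\<^bsub>generated_group M\<^esub> n = restrict (f ^^ n) ?L \<and> bij_betw (f ^^ n) ?L ?L" for n :: nat
  proof (induction n)
    case 0
    then show ?case by (simp add: nat_pow_def one_generated_group id_def bij_betw_def)
  next
    case (Suc n)
    have eq: "f ^^ Suc n = f ^^ n \<circ> f" by (simp add: funpow_Suc_right del: funpow.simps)
    have "restrict f ?L [^]\<^bsub>generated_group M\<^esub> Suc n =
        restrict f ?L [^]\<^bsub>generated_group M\<^esub> n \<otimes>\<^bsub>generated_group M\<^esub> restrict f ?L"
      by (simp add: nat_pow_def)
    moreover have "bij_betw (f ^^ Suc n) ?L ?L"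
      unfolding eq using assms Suc by (blast intro: bij_betw_trans)
    ultimately show ?case
      unfolding eq using Suc mult_generated_group[of "f ^^ n" M f] assms by metis
  qed
  moreover have "restrict (f ^^ n) ?L = restrict id ?L \<longleftrightarrow> (\<forall>v\<in>?L. (f ^^ n) v = v)" for n
    by (simp add: restrict_def fun_eq_iff Ball_def del: in_lists_conv_set)
  ultimately show ?thesis by (simp add: finite_order_def one_generated_group del: in_lists_conv_set)
qed

section \<open>Renaming states and letters by natural numbers\<close>

definition encode_mealy :: "('q::countable, 'a::countable) mealy \<Rightarrow> (nat, nat) mealy" where
  "encode_mealy M = \<lparr>states = to_nat ` states M, alphabet = to_nat ` alphabet M,
     transition = (\<lambda>p x. to_nat (transition M (from_nat p) (from_nat x))),
     emit = (\<lambda>p x. to_nat (emit M (from_nat p) (from_nat x)))\<rparr>"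

lemma run_encode_mealy:
  "run (encode_mealy M) (to_nat p) (map to_nat v) = map to_nat (run M p v)"
  by (induction v arbitrary: p) (simp_all add: encode_mealy_def)

lemma run_word_encode_mealy:
  "run_word (encode_mealy M) (map to_nat ps) (map to_nat v) = map to_nat (run_word M ps v)"
  by (induction ps arbitrary: v) (simp_all add: run_encode_mealy)

lemma lists_alphabet_encode_mealy:
  "lists (alphabet (encode_mealy M)) = map to_nat ` lists (alphabet M)"
  by (simp add: encode_mealy_def lists_image)

lemma mealy_automaton_encode_mealy:
  "mealy_automaton M \<Longrightarrow> mealy_automaton (encode_mealy M)"
  by (auto simp: mealy_automaton_def encode_mealy_def)

lemma invertible_automaton_encode_mealy:
  assumes "invertible_automaton M"
  shows "invertible_automaton (encode_mealy M)"
  unfolding invertible_automaton_def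
proof
  fix q assume "q \<in> states (encode_mealy M)"
  then obtain p where p: "q = to_nat p" "p \<in> states M" by (auto simp: encode_mealy_def)
  let ?L = "lists (alphabet M)"
  have bij: "bij_betw (run M p) ?L ?L" using assms p(2) by (simp add: invertible_automaton_def)
  have "inj_on (run (encode_mealy M) q) (map to_nat ` ?L)"
  proof (rule inj_onI)
    fix x y assume xy: "x \<in> map to_nat ` ?L" "y \<in> map to_nat ` ?L"
      "run (encode_mealy M) q x = run (encode_mealy M) q y"
    then obtain v w where "x = map to_nat v" "v \<in> ?L" "y = map to_nat w" "w \<in> ?L" by blast
    moreover from this xy(3) have "run M p v = run M p w"
      by (simp add: p(1) run_encode_mealy inj_map_eq_map)
    ultimately show "x = y" using inj_onD[OF bij_betw_imp_inj_on[OF bij]] by blast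
  qed
  moreover have "run (encode_mealy M) q ` map to_nat ` ?L = map to_nat ` run M p ` ?L"
    by (simp add: image_image p(1) run_encode_mealy)
  ultimately show "bij_betw (run (encode_mealy M) q) (lists (alphabet (encode_mealy M)))
      (lists (alphabet (encode_mealy M)))"
    using bij by (simp add: bij_betw_def lists_alphabet_encode_mealy)
qed

text \<open>Renaming is injective and commutes with the action of words, so the same powers act
  trivially. Orders can from here on be computed over the structured alphabet.\<close>

lemma finite_order_encode_mealy:
  assumes "invertible_automaton M" "ps \<in> lists (states M)"
  defines "M' \<equiv> encode_mealy M"
  shows "finite_order (generated_group M')
      (word_value (generated_group M') (map (\<lambda>p. restrict (run M' (to_nat p)) (lists (alphabet M'))) ps)) \<longleftrightarrow>
    (\<exists>n>0. \<forall>v\<in>lists (alphabet M). (run_word M ps ^^ n) v = v)"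
proof -
  have inv: "invertible_automaton M'"
    unfolding M'_def using assms(1) by (rule invertible_automaton_encode_mealy)
  have ps: "map to_nat ps \<in> lists (states M')"
    using assms(2) by (auto simp: M'_def encode_mealy_def)
  have "(run_word M' (map to_nat ps) ^^ n) (map to_nat v) = map to_nat ((run_word M ps ^^ n) v)" for n v
    by (induction n) (simp_all add: M'_def run_word_encode_mealy)
  then have "(\<forall>v\<in>lists (alphabet M'). (run_word M' (map to_nat ps) ^^ n) v = v) \<longleftrightarrow>
      (\<forall>v\<in>lists (alphabet M). (run_word M ps ^^ n) v = v)" for n
    unfolding M'_def lists_alphabet_encode_mealy
    by (simp add: M'_def[symmetric] inj_map_eq_map del: in_lists_conv_set)
  with word_value_generated_group[OF inv ps] finite_order_generated_group[OF bij_betw_run_word[OF inv ps]]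
  show ?thesis by (simp add: comp_def)
qed

section \<open>A group acting on counters\<close>

datatype gen = GI | GS | GU | GT nat | GTi nat

instance gen :: countable
  by countable_datatype

type_synonym letter = "nat list \<times> nat \<times> nat list"
type_synonym cell = "nat \<times> nat \<times> nat"

locale counter_group =
  fixes k r :: nat and delta :: "nat list \<Rightarrow> cell list option"
  assumes k_pos: "0 < k"
    and cells: "delta i = Some cs \<Longrightarrow> (a, v, b) \<in> set cs \<Longrightarrow> a < r \<and> b < r"
begin

definition positions :: "nat list set" where
  "positions = {x. set x \<subseteq> {..<k} \<and> length x = r}"

text \<open>The letter \<open>(i, m, x)\<close> is node \<open>m\<close> of the path attached to the residues \<open>i\<close>, at odometer
  position \<open>x\<close>. A cell \<open>(a, w, b)\<close> makes the odometer \<open>t\<^sub>a\<close> emit \<open>t\<^sub>b\<close> when it leaves a position with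
  \<open>a\<close>-th entry \<open>w\<close>; the \<open>c\<close>-th cell of \<open>delta i\<close> sits at node \<open>2 c\<close>, while odd nodes and the last
  node \<open>2 p\<close> emit nothing. No path is attached to \<open>i\<close> if \<open>delta i\<close> is undefined, which encodes
  halting.\<close>

definition letters :: "letter set" where
  "letters = {(i, m, x). i \<in> positions \<and> x \<in> positions \<and>
     (\<exists>cs. delta i = Some cs \<and> m \<le> 2 * length cs)}"

definition chain :: "nat list \<Rightarrow> cell list" where
  "chain i = (case delta i of None \<Rightarrow> [] | Some cs \<Rightarrow> cs)"

definition origin :: "nat list" where
  "origin = replicate r 0"

definition up :: "nat \<Rightarrow> nat list \<Rightarrow> nat list" where
  "up j x = x[j := Suc (x ! j) mod k]"

definition down :: "nat \<Rightarrow> nat list \<Rightarrow> nat list" where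
  "down j x = x[j := (x ! j + (k - 1)) mod k]"

text \<open>A reflection of the path: node 0 is fixed by truncated subtraction, and
  \<open>2 c - 1\<close> is exchanged with \<open>2 c\<close>.\<close>

definition flip_s :: "nat \<Rightarrow> nat" where
  "flip_s m = (if odd m then Suc m else m - 1)"

text \<open>The other reflection, exchanging \<open>2 c\<close> with \<open>2 c + 1\<close>. The
  last node would leave the path; the guard in \<open>out\<close> fixes it instead.\<close>

definition flip_u :: "nat \<Rightarrow> nat" where
  "flip_u m = (if even m then Suc m else m - 1)"

text \<open>The position tested is the one that \<open>GT j\<close> leaves. For \<open>GTi j\<close>
  it is the one reached, whence \<open>down j x\<close> in \<open>sec\<close>.\<close>

definition fires :: "nat list \<Rightarrow> nat \<Rightarrow> nat \<Rightarrow> nat list \<Rightarrow> bool" where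
  "fires i m j x \<longleftrightarrow> even m \<and> m < 2 * length (chain i) \<and>
     fst (chain i ! (m div 2)) = j \<and> fst (snd (chain i ! (m div 2))) = x ! j"

definition target :: "nat list \<Rightarrow> nat \<Rightarrow> nat" where
  "target i m = snd (snd (chain i ! (m div 2)))"

fun out :: "gen \<Rightarrow> letter \<Rightarrow> letter" where
  "out GI a = a"
| "out GS (i, m, x) = (if x = i then (i, flip_s m, x) else (i, m, x))"
| "out GU (i, m, x) = (if x = origin \<and> m < 2 * length (chain i) then (i, flip_u m, x) else (i, m, x))"
| "out (GT j) (i, m, x) = (i, m, up j x)"
| "out (GTi j) (i, m, x) = (i, m, down j x)"

fun sec :: "gen \<Rightarrow> letter \<Rightarrow> gen" where
  "sec GI a = GI"
| "sec GS (i, m, x) = (if x = i \<and> m = 0 then GS else GI)"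
| "sec GU (i, m, x) = (if x = origin \<and> m = 2 * length (chain i) then GU else GI)"
| "sec (GT j) (i, m, x) = (if fires i m j x then GT (target i m) else GI)"
| "sec (GTi j) (i, m, x) = (if fires i m j (down j x) then GTi (target i m) else GI)"

text \<open>Letters outside the alphabet are fixed and followed by the identity, so that the states act
  bijectively on all lists.\<close>

definition M :: "(gen, letter) mealy" where
  "M = \<lparr>states = {GI, GS, GU} \<union> GT ` {..<r} \<union> GTi ` {..<r}, alphabet = letters,
        transition = (\<lambda>p a. if a \<in> letters then sec p a else GI),
        emit = (\<lambda>p a. if a \<in> letters then out p a else a)\<rparr>"

abbreviation act :: "gen \<Rightarrow> letter list \<Rightarrow> letter list" where
  "act \<equiv> run M"

lemma act_Cons:
  "act p (a # v) = (if a \<in> letters then out p a # act (sec p a) v else a # act GI v)"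
  by (simp add: M_def)

lemma act_GI [simp]: "act GI v = v"
  by (induction v) (simp_all add: act_Cons del: run.simps(2))

declare run.simps(2) [simp del]

section \<open>Invertibility of the generators\<close>

lemma up_positions: "x \<in> positions \<Longrightarrow> up j x \<in> positions"
  using k_pos set_update_subset_insert[of x j] by (fastforce simp: positions_def up_def)

lemma down_positions: "x \<in> positions \<Longrightarrow> down j x \<in> positions"
  using k_pos set_update_subset_insert[of x j] by (fastforce simp: positions_def down_def)

lemma down_up: "x \<in> positions \<Longrightarrow> down j (up j x) = x"
proof (cases "j < r")
  case True
  assume x: "x \<in> positions"
  then have j: "x ! j < k" "j < length x"
    using True by (auto simp: positions_def subset_iff)
  then have "(Suc (x ! j) mod k + (k - 1)) mod k = x ! j"
    by (metis (no_types, lifting) Suc_diff_1 add_Suc_shift k_pos mod_add_left_eq mod_add_self2 mod_less)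
  then show ?thesis using j by (simp add: up_def down_def)
qed (auto simp: up_def down_def positions_def list_update_beyond)

lemma up_down: "x \<in> positions \<Longrightarrow> up j (down j x) = x"
proof (cases "j < r")
  case True
  assume x: "x \<in> positions"
  then have j: "x ! j < k" "j < length x"
    using True by (auto simp: positions_def subset_iff)
  then have "Suc ((x ! j + (k - 1)) mod k) mod k = x ! j"
    by (metis (no_types, lifting) Suc_diff_1 add_Suc_right k_pos mod_Suc_eq mod_add_self2 mod_less)
  then show ?thesis using j by (simp add: up_def down_def)
qed (auto simp: up_def down_def positions_def list_update_beyond)

lemma lettersE:
  assumes "(i, m, x) \<in> letters"
  shows "i \<in> positions" "x \<in> positions" "m \<le> 2 * length (chain i)" "delta i = Some (chain i)"
  using assms by (auto simp: letters_def chain_def)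

lemma lettersI:
  assumes "i \<in> positions" "x \<in> positions" "m \<le> 2 * length (chain i)" "delta i \<noteq> None"
  shows "(i, m, x) \<in> letters"
  using assms by (auto simp: letters_def chain_def)

lemma flip_s_flip_s [simp]: "flip_s (flip_s m) = m"
  by (auto simp: flip_s_def elim: oddE evenE) 

lemma flip_u_flip_u [simp]: "flip_u (flip_u m) = m"
  by (auto simp: flip_u_def)

lemma flip_s_le: "m \<le> 2 * p \<Longrightarrow> flip_s m \<le> 2 * p"
  by (auto simp: flip_s_def) presburger+

lemma flip_u_less: "m < 2 * p \<Longrightarrow> flip_u m < 2 * p"
  by (auto simp: flip_u_def elim!: evenE)

lemma out_letters: "a \<in> letters \<Longrightarrow> out p a \<in> letters"
proof (cases a)
  case (fields i m x)
  assume "a \<in> letters"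
  with fields show ?thesis
    using lettersE[of i m x] flip_s_le[of m "length (chain i)"] flip_u_less[of m "length (chain i)"]
    by (cases p) (auto intro!: lettersI up_positions down_positions)
qed

text \<open>The section \<open>GS\<close> occurs only at node 0, which \<open>flip_s\<close> fixes,
  so both passes meet the same section.\<close>

lemma act_GS_GS [simp]: "act GS (act GS v) = v"
proof (induction v)
  case (Cons a v)
  obtain i m x where a: "a = (i, m, x)" by (cases a)
  have "flip_s 0 = 0" "0 < m \<Longrightarrow> flip_s m \<noteq> 0"
    by (auto simp: flip_s_def elim: oddE)
  with Cons a out_letters[of a GS] show ?case
    by (auto simp: act_Cons)
qed simp

lemma act_GU_GU [simp]: "act GU (act GU v) = v"
proof (induction v)
  case (Cons a v)
  obtain i m x where a: "a = (i, m, x)" by (cases a)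
  with Cons out_letters[of a GU] flip_u_less[of m "length (chain i)"] show ?case
    by (auto simp: act_Cons)
qed simp

text \<open>Both generators test the position before the upward move, so their sections are again
  mutually inverse.\<close>

lemma act_GTi_GT [simp]: "act (GTi j) (act (GT j) v) = v"
proof (induction v arbitrary: j)
  case (Cons a v)
  obtain i m x where a: "a = (i, m, x)" by (cases a)
  with Cons out_letters[of a "GT j"] down_up[of x j] show ?case
    by (auto simp: act_Cons dest: lettersE)
qed simp

lemma act_GT_GTi [simp]: "act (GT j) (act (GTi j) v) = v"
proof (induction v arbitrary: j)
  case (Cons a v)
  obtain i m x where a: "a = (i, m, x)" by (cases a)
  with Cons out_letters[of a "GTi j"] up_down[of x j] show ?case
    by (auto simp: act_Cons dest: lettersE)
qed simp

lemma funpow_left_inverse: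
  fixes f g :: "'b \<Rightarrow> 'b"
  assumes "\<And>v. f (g v) = v"
  shows "(f ^^ n) ((g ^^ n) v) = v"
proof (induction n)
  case (Suc n)
  have "(f ^^ Suc n) ((g ^^ Suc n) v) = (f ^^ n) (f (g ((g ^^ n) v)))"
    by (simp add: funpow_swap1)
  then show ?case using Suc assms by simp
qed simp

section \<open>Powers and products of odometers\<close>

text \<open>How often a counter modulo \<open>k\<close>, started at 0, leaves the residue
  \<open>w\<close> during \<open>n\<close> increments.\<close>

definition count_mod :: "nat \<Rightarrow> nat \<Rightarrow> nat" where
  "count_mod w n = card {l. l < n \<and> l mod k = w}"

lemma count_mod_0 [simp]: "count_mod w 0 = 0"
  by (simp add: count_mod_def)

lemma count_mod_Suc: "count_mod w (Suc n) = (if n mod k = w then Suc (count_mod w n) else count_mod w n)"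
proof -
  have "{l. l < Suc n \<and> l mod k = w} = (if n mod k = w then insert n else id) {l. l < n \<and> l mod k = w}"
    by (auto simp: less_Suc_eq)
  then show ?thesis by (simp add: count_mod_def)
qed

text \<open>The conjugator \<open>F\<close>, with a variable list of indices to allow
  induction.\<close>

definition shift_word :: "nat list \<Rightarrow> nat list \<Rightarrow> letter list \<Rightarrow> letter list" where
  "shift_word js ns = foldr (\<lambda>j f. (act (GT j) ^^ (ns ! j)) \<circ> f) js id"

definition unshift_word :: "nat list \<Rightarrow> nat list \<Rightarrow> letter list \<Rightarrow> letter list" where
  "unshift_word js ns = foldr (\<lambda>j f. f \<circ> (act (GTi j) ^^ (ns ! j))) js id"

abbreviation shift :: "nat list \<Rightarrow> letter list \<Rightarrow> letter list" where
  "shift \<equiv> shift_word [0..<r]"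

abbreviation unshift :: "nat list \<Rightarrow> letter list \<Rightarrow> letter list" where
  "unshift \<equiv> unshift_word [0..<r]"

lemma unshift_word_shift_word [simp]: "unshift_word js ns (shift_word js ns v) = v"
  by (induction js arbitrary: v) (simp_all add: shift_word_def unshift_word_def funpow_left_inverse)

lemma shift_word_unshift_word [simp]: "shift_word js ns (unshift_word js ns v) = v"
  by (induction js arbitrary: v) (simp_all add: shift_word_def unshift_word_def funpow_left_inverse)

text \<open>What the cell emits while \<open>F\<close> moves its letter away from the origin:
  \<open>GT a\<close> is applied \<open>ns ! a\<close> times and emits \<open>GT b\<close> whenever
  it leaves residue \<open>w\<close>.\<close>

definition cell_word :: "nat list \<Rightarrow> cell \<Rightarrow> letter list \<Rightarrow> letter list" where
  "cell_word ns = (\<lambda>(a, w, b). act (GT b) ^^ count_mod w (ns ! a))"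

definition cell_unword :: "nat list \<Rightarrow> cell \<Rightarrow> letter list \<Rightarrow> letter list" where
  "cell_unword ns = (\<lambda>(a, w, b). act (GTi b) ^^ count_mod w (ns ! a))"

lemma cell_unword_cell_word [simp]: "cell_unword ns c (cell_word ns c v) = v"
  by (simp add: cell_word_def cell_unword_def funpow_left_inverse split: prod.split)

lemma cell_word_cell_unword [simp]: "cell_word ns c (cell_unword ns c v) = v"
  by (simp add: cell_word_def cell_unword_def funpow_left_inverse split: prod.split)

definition active :: "nat list \<Rightarrow> nat \<Rightarrow> bool" where
  "active i m \<longleftrightarrow> even m \<and> m < 2 * length (chain i)"

definition node_word :: "nat list \<Rightarrow> nat list \<Rightarrow> nat \<Rightarrow> letter list \<Rightarrow> letter list" where
  "node_word ns i m = (if active i m then cell_word ns (chain i ! (m div 2)) else id)"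

definition node_unword :: "nat list \<Rightarrow> nat list \<Rightarrow> nat \<Rightarrow> letter list \<Rightarrow> letter list" where
  "node_unword ns i m = (if active i m then cell_unword ns (chain i ! (m div 2)) else id)"

lemma node_word_node_unword [simp]: "node_word ns i m (node_unword ns i m v) = v"
  by (simp add: node_word_def node_unword_def)

lemma act_GT_funpow:
  assumes "(i, m, x) \<in> letters" "x ! j = 0" "j < r"
  shows "(act (GT j) ^^ n) ((i, m, x) # v) = (i, m, x[j := n mod k]) #
    (if active i m \<and> fst (chain i ! (m div 2)) = j
     then (act (GT (target i m)) ^^ count_mod (fst (snd (chain i ! (m div 2)))) n) v else v)"
proof (induction n)
  case 0
  then show ?case using assms by simp (metis list_update_id)
next
  case (Suc n)
  have x: "length x = r" "x \<in> positions" using lettersE(2)[OF assms(1)] by (auto simp: positions_def)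
  have "(i, m, x[j := n mod k]) \<in> letters"
    using assms(1) k_pos x set_update_subset_insert[of x j "n mod k"]
    by (auto simp: letters_def positions_def subset_iff)
  moreover have "up j (x[j := n mod k]) = x[j := Suc n mod k]"
    using x assms(3) by (simp add: up_def mod_Suc_eq)
  ultimately show ?case
    using x assms(3) Suc by (auto simp: act_Cons active_def fires_def count_mod_Suc)
qed

lemma length_foldr_update [simp]: "length (foldr (\<lambda>j x. x[j := h j]) js x) = length x"
  by (induction js) simp_all

lemma nth_foldr_update:
  assumes "l < length x"
  shows "foldr (\<lambda>j x. x[j := h j]) js x ! l = (if l \<in> set js then h l else x ! l)"
proof (induction js)
  case (Cons j js)
  then show ?case using assms by (cases "j = l") auto
qed simp

text \<open>Distinct odometers change distinct entries, so each of them starts at 0. A node carries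
  at most one cell, so at most one factor emits. Membership in \<open>letters\<close> is carried
  along for the induction.\<close>

lemma shift_word_Cons:
  assumes "(i, m, x) \<in> letters" "distinct js" "set js \<subseteq> {..<r}" "\<And>j. j \<in> set js \<Longrightarrow> x ! j = 0"
  shows "shift_word js ns ((i, m, x) # v) = (i, m, foldr (\<lambda>j x. x[j := ns ! j mod k]) js x) #
    (if active i m \<and> fst (chain i ! (m div 2)) \<in> set js
     then cell_word ns (chain i ! (m div 2)) v else v)
   \<and> (i, m, foldr (\<lambda>j x. x[j := ns ! j mod k]) js x) \<in> letters"
  using assms(2-4)
proof (induction js)
  case Nil
  then show ?case using assms(1) by (simp add: shift_word_def)
next
  case (Cons j js)
  define y where "y = foldr (\<lambda>j x. x[j := ns ! j mod k]) js x"
  have j: "j < r" and x: "length x = r" using Cons.prems assms(1)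
    by (auto dest: lettersE simp: positions_def)
  have IH: "shift_word js ns ((i, m, x) # v) = (i, m, y) #
    (if active i m \<and> fst (chain i ! (m div 2)) \<in> set js
     then cell_word ns (chain i ! (m div 2)) v else v)" "(i, m, y) \<in> letters"
    using Cons by (auto simp: y_def)
  have y0: "y ! j = 0" using nth_foldr_update[of j x "\<lambda>j. ns ! j mod k" js] j x Cons.prems
    by (auto simp: y_def)
  have "(i, m, y[j := ns ! j mod k]) \<in> letters"
    using IH(2) k_pos set_update_subset_insert[of y j "ns ! j mod k"]
    by (auto simp: letters_def positions_def subset_iff)
  moreover have "shift_word (j # js) ns w = (act (GT j) ^^ (ns ! j)) (shift_word js ns w)" for w
    by (simp add: shift_word_def)
  ultimately show ?case
    using act_GT_funpow[OF IH(2) y0 j, of "ns ! j"] Cons.prems IH(1)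
    by (auto simp: y_def[symmetric] cell_word_def target_def split: prod.splits)
qed

definition res :: "nat list \<Rightarrow> nat list" where
  "res ns = map (\<lambda>n. n mod k) ns"

lemma res_positions: "length ns = r \<Longrightarrow> res ns \<in> positions"
  using k_pos by (auto simp: res_def positions_def)

lemma origin_positions: "origin \<in> positions"
  using k_pos by (auto simp: origin_def positions_def)

lemma shift_origin:
  assumes "(i, m, x) \<in> letters" "length ns = r"
  shows "shift ns ((i, m, origin) # v) = (i, m, res ns) # node_word ns i m v"
proof -
  have l: "(i, m, origin) \<in> letters" using assms(1) origin_positions by (auto simp: letters_def)
  have 1: "foldr (\<lambda>j x. x[j := ns ! j mod k]) [0..<r] origin = res ns"
    using assms(2) nth_foldr_update[where x = origin and h = "\<lambda>j. ns ! j mod k" and js = "[0..<r]"]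
    by (intro nth_equalityI) (simp_all add: res_def origin_def)
  \<comment> \<open>The odometer read by the cell is among the factors of \<open>shift\<close>, so
    the cell word is indeed emitted.\<close>
  have 2: "fst (chain i ! (m div 2)) < r" if "active i m"
  proof -
    obtain a w b where c: "chain i ! (m div 2) = (a, w, b)" by (cases "chain i ! (m div 2)")
    moreover have "(a, w, b) \<in> set (chain i)"
      using that c by (metis active_def less_mult_imp_div_less mult.commute nth_mem)
    ultimately show ?thesis using cells lettersE(4)[OF l] by simp
  qed
  show ?thesis
    using shift_word_Cons[OF l, of "[0..<r]" ns v] 1 2
    by (auto simp: origin_def node_word_def lessThan_atLeast0)
qed

lemma shift_Nil [simp]: "shift_word js ns [] = []"
proof -
  have "(act (GT j) ^^ n) [] = []" for j n by (induction n) auto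
  then show ?thesis by (induction js) (auto simp: shift_word_def)
qed

section \<open>The elements attached to counter tuples\<close>

definition conj_u :: "nat list \<Rightarrow> letter list \<Rightarrow> letter list" where
  "conj_u ns = shift ns \<circ> act GU \<circ> unshift ns"

definition config_elem :: "nat list \<Rightarrow> letter list \<Rightarrow> letter list" where
  "config_elem ns = conj_u ns \<circ> act GS"

text \<open>\<open>GU\<close> acts nontrivially only on letters at the origin, and
  \<open>shift\<close> takes the origin to \<open>res ns\<close>.\<close>

lemma conj_u_off:
  assumes "length ns = r" "a \<in> letters \<Longrightarrow> snd (snd a) \<noteq> res ns"
  shows "conj_u ns (a # v) = a # v"
proof -
  have "act GU (unshift ns (a # v)) = unshift ns (a # v)"
  proof (cases "unshift ns (a # v)")
    case (Cons b w)
    have F: "shift ns (b # w) = a # v" using Cons by (metis shift_word_unshift_word)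
    obtain i m x where b: "b = (i, m, x)" by (cases b)
    show ?thesis
    proof (cases "b \<in> letters \<and> x = origin")
      case True
      then have "a = (i, m, res ns)" using F b shift_origin[of i m origin ns w] assms(1) by auto
      moreover have "(i, m, res ns) \<in> letters"
        using True b res_positions[OF assms(1)] by (auto simp: letters_def)
      ultimately show ?thesis using assms(2) by auto
    next
      case False
      then show ?thesis using Cons b by (auto simp: act_Cons)
    qed
  qed simp
  then show ?thesis by (simp add: conj_u_def)
qed

text \<open>\<open>unshift\<close> moves the letter to the origin, \<open>GU\<close> flips the node,
  \<open>shift\<close> moves it back. Of two nodes exchanged by \<open>flip_u\<close> only the even
  one is active, so one of the two node words is trivial; at the last node both are, and
  \<open>GU\<close> passes to the rest.\<close>

lemma conj_u_on:
  assumes "(i, m, res ns) \<in> letters" "length ns = r"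
  shows "conj_u ns ((i, m, res ns) # v) =
    (if m < 2 * length (chain i)
     then (i, flip_u m, res ns) # node_word ns i (flip_u m) (node_unword ns i m v)
     else (i, m, res ns) # act GU v)"
proof -
  have "unshift ns ((i, m, res ns) # v) = unshift ns (shift ns ((i, m, origin) # node_unword ns i m v))"
    using shift_origin[OF assms] by simp
  then have 1: "unshift ns ((i, m, res ns) # v) = (i, m, origin) # node_unword ns i m v"
    by simp
  have l: "(i, m, origin) \<in> letters" "m \<le> 2 * length (chain i)"
    using assms(1) origin_positions lettersE(3)[OF assms(1)] by (auto simp: letters_def)
  have l': "(i, flip_u m, origin) \<in> letters" if "m < 2 * length (chain i)"
    using out_letters[OF l(1), of GU] that by simp
  show ?thesis
    using l l' 1 shift_origin[OF _ assms(2)]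
    by (auto simp: conj_u_def act_Cons node_word_def node_unword_def active_def)
qed

lemma conj_u_conj_u [simp]: "conj_u ns (conj_u ns v) = v"
  by (simp add: conj_u_def)

text \<open>At most one of the two involutions acts: away from position \<open>res ns\<close> the
  conjugate of \<open>GU\<close> is trivial, and at this position \<open>GS\<close> is trivial when
  the path belongs to other residues. Both situations persist under the action.\<close>

lemma config_elem_off:
  assumes "length ns = r" "a \<in> letters \<Longrightarrow> snd (snd a) \<noteq> res ns \<or> fst a \<noteq> res ns"
  shows "config_elem ns (config_elem ns (a # v)) = a # v"
proof (cases "a \<in> letters \<and> snd (snd a) = res ns")
  case False
  obtain b w where S: "act GS (a # v) = b # w" using act_Cons by metis
  obtain i m x where a: "a = (i, m, x)" by (cases a)
  have "b \<in> letters \<Longrightarrow> snd (snd b) \<noteq> res ns"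
    using S False a by (auto simp: act_Cons split: if_splits)
  with S conj_u_off[OF assms(1)] have "config_elem ns (a # v) = act GS (a # v)" by (simp add: config_elem_def)
  moreover have "config_elem ns (a # v) = b # w" using S calculation by simp
  moreover have "act GS (b # w) = a # v" using S act_GS_GS by metis
  ultimately show ?thesis using False conj_u_off[OF assms(1), of a v]
    by (auto simp: config_elem_def)
next
  case True
  obtain i m x where a: "a = (i, m, x)" by (cases a)
  have x: "x = res ns" "i \<noteq> x" using True a assms(2) by auto
  have l: "(i, m, res ns) \<in> letters" using True a x by auto
  have "act GS ((i, m', res ns) # w) = (i, m', res ns) # w" for m' w
    using x by (auto simp: act_Cons)
  moreover have "\<exists>m' w. conj_u ns (a # v) = (i, m', res ns) # w"
    using conj_u_on[OF l assms(1)] a x by auto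
  moreover have "conj_u ns (conj_u ns (a # v)) = a # v" by simp
  ultimately show ?thesis using a x by (metis comp_apply config_elem_def)
qed

definition has_finite_order :: "nat list \<Rightarrow> bool" where
  "has_finite_order ns \<longleftrightarrow> (\<exists>N>0. \<forall>v. (config_elem ns ^^ N) v = v)"

lemma funpow_fixed: "f v = v \<Longrightarrow> (f ^^ n) v = v"
  by (induction n) auto

lemma funpow_fixed_mult: "(f ^^ m) v = v \<Longrightarrow> (f ^^ (m * n)) v = v"
  by (simp add: funpow_fixed flip: funpow_mult)

lemma funpow_commute: "(f ^^ a) ((f ^^ b) v) = (f ^^ b) ((f ^^ a) v)"
proof -
  have "f ^^ (a + b) = f ^^ (b + a)" by (simp only: add.commute)
  then show ?thesis by (simp only: funpow_add fun_eq_iff comp_apply)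
qed

lemma funpow_mod_div: "(f ^^ n) v = (f ^^ (n mod p)) (((f ^^ p) ^^ (n div p)) v)"
proof -
  have "(f ^^ n) v = (f ^^ (n mod p + p * (n div p))) v" by simp
  then show ?thesis by (simp only: funpow_add funpow_mult comp_apply)
qed

text \<open>No path is attached to \<open>res ns\<close>, so \<open>config_elem_off\<close> applies
  to every first letter.\<close>

lemma halting_finite_order:
  assumes "length ns = r" "delta (res ns) = None"
  shows "has_finite_order ns"
proof -
  have "(config_elem ns ^^ 2) v = v" for v
  proof (cases v)
    case Nil
    have "conj_u ns [] = []"
      by (simp add: conj_u_def) (metis shift_Nil run.simps(1) unshift_word_shift_word)
    then show ?thesis using Nil by (simp add: config_elem_def numeral_2_eq_2)
  next
    case (Cons a v')
    have "a \<in> letters \<Longrightarrow> fst a \<noteq> res ns" using assms(2) by (auto simp: letters_def)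
    with config_elem_off[OF assms(1)] Cons show ?thesis by (simp add: numeral_2_eq_2)
  qed
  then show ?thesis unfolding has_finite_order_def by (metis zero_less_numeral)
qed

section \<open>The orbit of node 0\<close>

definition cells_word :: "nat list \<Rightarrow> cell list \<Rightarrow> letter list \<Rightarrow> letter list" where
  "cells_word ns cs = foldr (\<lambda>c f. cell_word ns c \<circ> f) cs id"

definition cells_unword :: "nat list \<Rightarrow> cell list \<Rightarrow> letter list \<Rightarrow> letter list" where
  "cells_unword ns cs = foldr (\<lambda>c f. f \<circ> cell_unword ns c) cs id"

lemma cells_word_append: "cells_word ns (cs @ ds) v = cells_word ns cs (cells_word ns ds v)"
  by (induction cs arbitrary: v) (simp_all add: cells_word_def)

lemma cells_unword_append: "cells_unword ns (cs @ ds) v = cells_unword ns ds (cells_unword ns cs v)"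
  by (induction cs arbitrary: v) (simp_all add: cells_unword_def)

lemma cells_word_cells_unword [simp]: "cells_word ns cs (cells_unword ns cs v) = v"
  by (induction cs arbitrary: v) (simp_all add: cells_word_def cells_unword_def)

lemma cells_unword_cells_word [simp]: "cells_unword ns cs (cells_word ns cs v) = v"
  by (induction cs arbitrary: v) (simp_all add: cells_word_def cells_unword_def)

context
  fixes ns cs
  assumes len: "length ns = r" and delta: "delta (res ns) = Some cs"
begin

lemma chain_res: "chain (res ns) = cs"
  using delta by (simp add: chain_def)

lemma main_letters: "(res ns, m, res ns) \<in> letters \<longleftrightarrow> m \<le> 2 * length cs"
  using delta res_positions[OF len] by (auto simp: letters_def)

lemma act_GS_main:
  "m \<le> 2 * length cs \<Longrightarrow>
   act GS ((res ns, m, res ns) # v) = (res ns, flip_s m, res ns) # (if m = 0 then act GS v else v)"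
  using main_letters by (simp add: act_Cons)

text \<open>The orbit climbs through the nodes \<open>0, 1, 3, 5, ...\<close>. The case distinction
  accounts for the start, where \<open>GS\<close> fixes node 0 and passes to the rest.\<close>

lemma config_elem_up:
  "j < length cs \<Longrightarrow> config_elem ns ((res ns, (if j = 0 then 0 else 2 * j - 1), res ns) # v) =
     (res ns, 2 * j + 1, res ns) # cell_unword ns (cs ! j) (if j = 0 then act GS v else v)"
proof -
  assume j: "j < length cs"
  have "act GS ((res ns, (if j = 0 then 0 else 2 * j - 1), res ns) # v) =
    (res ns, 2 * j, res ns) # (if j = 0 then act GS v else v)"
    using j act_GS_main[of "if j = 0 then 0 else 2 * j - 1" v] by (auto simp: flip_s_def)
  moreover have "conj_u ns ((res ns, 2 * j, res ns) # w) =
      (res ns, 2 * j + 1, res ns) # cell_unword ns (cs ! j) w" for w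
    using conj_u_on[of "res ns" "2 * j" ns w] j main_letters[of "2 * j"] len
    by (simp add: chain_res flip_u_def node_word_def node_unword_def active_def)
  ultimately show ?thesis by (simp add: config_elem_def)
qed

text \<open>The turning point. For empty \<open>cs\<close> the first and the last node coincide, and
  \<open>GS\<close> and \<open>GU\<close> both pass to the rest in one step.\<close>

lemma config_elem_top:
  "config_elem ns ((res ns, (if length cs = 0 then 0 else 2 * length cs - 1), res ns) # v) =
     (res ns, 2 * length cs, res ns) # act GU (if length cs = 0 then act GS v else v)"
proof -
  have "act GS ((res ns, (if length cs = 0 then 0 else 2 * length cs - 1), res ns) # v) =
    (res ns, 2 * length cs, res ns) # (if length cs = 0 then act GS v else v)"
    using act_GS_main[of "if length cs = 0 then 0 else 2 * length cs - 1" v]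
    by (cases "length cs") (auto simp: flip_s_def)
  moreover have "conj_u ns ((res ns, 2 * length cs, res ns) # w) =
      (res ns, 2 * length cs, res ns) # act GU w" for w
    using conj_u_on[of "res ns" "2 * length cs" ns w] main_letters[of "2 * length cs"] len
    by (simp add: chain_res)
  ultimately show ?thesis by (simp add: config_elem_def)
qed

lemma config_elem_down:
  "j < length cs \<Longrightarrow> config_elem ns ((res ns, 2 * Suc j, res ns) # v) =
     (res ns, 2 * j, res ns) # cell_word ns (cs ! j) v"
proof -
  assume j: "j < length cs"
  have "act GS ((res ns, 2 * Suc j, res ns) # v) = (res ns, 2 * j + 1, res ns) # v"
    using j act_GS_main[of "2 * Suc j" v] by (auto simp: flip_s_def)
  moreover have "conj_u ns ((res ns, 2 * j + 1, res ns) # w) =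
      (res ns, 2 * j, res ns) # cell_word ns (cs ! j) w" for w
    using conj_u_on[of "res ns" "2 * j + 1" ns w] j main_letters[of "2 * j + 1"] len
    by (simp add: chain_res flip_u_def node_word_def node_unword_def active_def)
  ultimately show ?thesis by (simp add: config_elem_def)
qed

lemma config_elem_phase_up:
  "j \<le> length cs \<Longrightarrow> (config_elem ns ^^ j) ((res ns, 0, res ns) # v) =
     (res ns, (if j = 0 then 0 else 2 * j - 1), res ns) #
     (if j = 0 then v else cells_unword ns (take j cs) (act GS v))"
proof (induction j)
  case (Suc j)
  then show ?case
    by (auto simp: config_elem_up take_Suc_conv_app_nth cells_unword_append simp del: mult_Suc_right)
      (simp_all add: cells_unword_def)
qed simp

lemma config_elem_phase_top:
  "(config_elem ns ^^ Suc (length cs)) ((res ns, 0, res ns) # v) =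
     (res ns, 2 * length cs, res ns) # act GU (cells_unword ns cs (act GS v))"
  using config_elem_phase_up[of "length cs" v] config_elem_top
  by (auto simp: cells_unword_def)

text \<open>Every rest has this form because the cell words are invertible; \<open>w\<close> is the
  rest left after \<open>j\<close> descents.\<close>

lemma config_elem_phase_down:
  "j \<le> length cs \<Longrightarrow>
   (config_elem ns ^^ j) ((res ns, 2 * length cs, res ns) # cells_unword ns cs (cells_word ns (take (length cs - j) cs) w)) =
     (res ns, 2 * (length cs - j), res ns) # w"
proof (induction j arbitrary: w)
  case (Suc j)
  define l where "l = length cs - Suc j"
  have l: "length cs - j = Suc l" "l < length cs" using Suc.prems by (auto simp: l_def)
  have "cells_word ns (take l cs) w = cells_word ns (take (Suc l) cs) (cell_unword ns (cs ! l) w)"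
    using l by (simp add: take_Suc_conv_app_nth cells_word_append) (simp add: cells_word_def)
  with Suc l show ?case
    by (simp add: config_elem_down l_def[symmetric] del: mult_Suc_right)
qed simp

text \<open>With \<open>p = length cs\<close>, there are \<open>p\<close> steps up, one at the top
  and \<open>p\<close> down. The rest undergoes \<open>GS\<close> and then \<open>GU\<close>
  conjugated by the product of the cell words, which is a \<open>config_elem\<close> again once that
  product is a \<open>shift\<close>.\<close>

lemma orbit_return:
  "(config_elem ns ^^ (2 * length cs + 1)) ((res ns, 0, res ns) # v) =
     (res ns, 0, res ns) # cells_word ns cs (act GU (cells_unword ns cs (act GS v)))"
proof -
  have "2 * length cs + 1 = length cs + Suc (length cs)" by simp
  then have "(config_elem ns ^^ (2 * length cs + 1)) ((res ns, 0, res ns) # v) =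
    (config_elem ns ^^ length cs) ((res ns, 2 * length cs, res ns) # act GU (cells_unword ns cs (act GS v)))"
    by (simp only: funpow_add comp_apply config_elem_phase_top)
  also have "\<dots> = (res ns, 0, res ns) # cells_word ns cs (act GU (cells_unword ns cs (act GS v)))"
    using config_elem_phase_down[of "length cs" "cells_word ns cs (act GU (cells_unword ns cs (act GS v)))"]
    by (simp add: cells_word_def[of ns "[]"])
  finally show ?thesis .
qed

lemma orbit_elsewhere:
  assumes "0 < l" "l < 2 * length cs + 1"
  shows "hd ((config_elem ns ^^ l) ((res ns, 0, res ns) # v)) \<noteq> (res ns, 0, res ns)"
proof (cases "l \<le> length cs")
  case True
  then show ?thesis using config_elem_phase_up[of l v] assms by simp
next
  case False
  define j where "j = l - Suc (length cs)"
  with False assms have j: "l = j + Suc (length cs)" "j < length cs" by auto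
  define w where "w = cells_unword ns (take (length cs - j) cs) (cells_word ns cs (act GU (cells_unword ns cs (act GS v))))"
  have "(config_elem ns ^^ l) ((res ns, 0, res ns) # v) =
    (config_elem ns ^^ j) ((res ns, 2 * length cs, res ns) # act GU (cells_unword ns cs (act GS v)))"
    by (simp only: j funpow_add comp_apply config_elem_phase_top)
  also have "\<dots> = (res ns, 2 * (length cs - j), res ns) # w"
    using config_elem_phase_down[of j w] j by (simp add: w_def)
  finally show ?thesis using j by simp
qed

text \<open>Odd nodes are met on the way up, even ones from the top downwards, with node 0 met at
  the return. Inverting the words collected on the way yields the initial rest
  \<open>v\<close>.\<close>

lemma orbit_covers:
  assumes "m \<le> 2 * length cs"
  shows "\<exists>l v. (config_elem ns ^^ l) ((res ns, 0, res ns) # v) = (res ns, m, res ns) # w"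
proof (cases "even m")
  case True
  then obtain a where a: "m = 2 * a" by (auto elim: evenE)
  define j where "j = length cs - a"
  define v where "v = act GS (cells_word ns cs (act GU (cells_unword ns cs (cells_word ns (take a cs) w))))"
  have "(config_elem ns ^^ (j + Suc (length cs))) ((res ns, 0, res ns) # v) =
    (config_elem ns ^^ j) ((res ns, 2 * length cs, res ns) # act GU (cells_unword ns cs (act GS v)))"
    by (simp only: funpow_add comp_apply config_elem_phase_top)
  also have "\<dots> = (res ns, m, res ns) # w"
    using config_elem_phase_down[of j w] a assms by (simp add: v_def j_def)
  finally show ?thesis by blast
next
  case False
  then obtain a where a: "m = 2 * a + 1" by (auto elim: oddE)
  with assms config_elem_phase_up[of "Suc a" "act GS (cells_word ns (take (Suc a) cs) w)"] show ?thesis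
    by (intro exI[of _ "Suc a"]) auto
qed

text \<open>Here \<open>ns'\<close> is a successor of \<open>ns\<close>: its conjugator is the
  product of the cell words along the path.\<close>

context
  fixes ns'
  assumes shift': "shift ns' = cells_word ns cs"
begin

lemma unshift': "unshift ns' = cells_unword ns cs"
proof
  fix v
  have "unshift ns' v = unshift ns' (shift ns' (cells_unword ns cs v))"
    by (simp add: shift')
  then show "unshift ns' v = cells_unword ns cs v" by simp
qed

lemma orbit_return': "((config_elem ns ^^ (2 * length cs + 1)) ^^ q) ((res ns, 0, res ns) # v) =
    (res ns, 0, res ns) # (config_elem ns' ^^ q) v"
proof (induction q)
  case (Suc q)
  have "config_elem ns' w = cells_word ns cs (act GU (cells_unword ns cs (act GS w)))" for w
    by (simp add: config_elem_def conj_u_def shift' unshift')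
  with Suc orbit_return show ?case by simp
qed simp

text \<open>By \<open>orbit_elsewhere\<close> node 0 recurs only at multiples of the return time,
  which therefore divides \<open>N\<close>; the quotient acts below as a power of
  \<open>config_elem ns'\<close>.\<close>

lemma finite_order_descends:
  assumes "\<And>v. (config_elem ns ^^ N) v = v" "0 < N"
  shows "\<exists>q>0. q * (2 * length cs + 1) = N \<and> (\<forall>v. (config_elem ns' ^^ q) v = v)"
proof -
  let ?p = "2 * length cs + 1"
  let ?q = "N div ?p"
  have eq: "(config_elem ns ^^ (N mod ?p)) ((res ns, 0, res ns) # (config_elem ns' ^^ ?q) v) = (res ns, 0, res ns) # v" for v
  proof -
    have "(config_elem ns ^^ (N mod ?p)) (((config_elem ns ^^ ?p) ^^ ?q) w) = w" for w
      using assms(1)[of w] funpow_mod_div[of N "config_elem ns" w ?p] by simp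
    then show ?thesis by (simp only: orbit_return'[symmetric])
  qed
  have 0: "N mod ?p = 0"
  proof (rule ccontr)
    assume "N mod ?p \<noteq> 0"
    then have "hd ((config_elem ns ^^ (N mod ?p)) ((res ns, 0, res ns) # (config_elem ns' ^^ ?q) [])) \<noteq> (res ns, 0, res ns)"
      using orbit_elsewhere[of "N mod ?p"] by simp
    then show False using eq[of "[]"] by simp
  qed
  then have "?q * ?p = N" by (metis dvd_div_mult_self mod_0_imp_dvd)
  moreover have "(config_elem ns' ^^ ?q) v = v" for v using eq[of v] 0 by simp
  moreover have "0 < ?q" using \<open>?q * ?p = N\<close> assms(2) by (intro Nat.gr0I) auto
  ultimately show ?thesis by blast
qed

text \<open>The factor 2 serves the letters of \<open>config_elem_off\<close>. Each node of the path
  lies in the orbit of node 0, where the return time times \<open>N\<close> suffices, and powers of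
  one map commute.\<close>

lemma finite_order_lifts:
  assumes "\<And>v. (config_elem ns' ^^ N) v = v"
  shows "(config_elem ns ^^ (2 * ((2 * length cs + 1) * N))) v = v"
proof (cases v)
  case Nil
  have "conj_u ns [] = []"
    by (simp add: conj_u_def) (metis shift_Nil run.simps(1) unshift_word_shift_word)
  then show ?thesis using Nil by (simp add: config_elem_def funpow_fixed)
next
  case (Cons a w)
  let ?K = "(2 * length cs + 1) * N"
  show ?thesis
  proof (cases "a \<in> letters \<and> fst a = res ns \<and> snd (snd a) = res ns")
    case False
    then have "a \<in> letters \<Longrightarrow> snd (snd a) \<noteq> res ns \<or> fst a \<noteq> res ns" by blast
    then have "(config_elem ns ^^ 2) v = v"
      using config_elem_off[OF len] Cons by (simp add: numeral_2_eq_2)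
    then show ?thesis by (rule funpow_fixed_mult)
  next
    case True
    obtain m where a: "a = (res ns, m, res ns)" "m \<le> 2 * length cs"
      using True main_letters by (cases a) auto
    obtain l w' where lw: "(config_elem ns ^^ l) ((res ns, 0, res ns) # w') = v"
      using orbit_covers[OF a(2)] a(1) Cons by metis
    have "(config_elem ns ^^ ?K) ((res ns, 0, res ns) # w') = (res ns, 0, res ns) # w'"
      using orbit_return'[of N w'] assms by (simp only: funpow_mult)
    then have "(config_elem ns ^^ ?K) v = v"
      by (simp only: lw[symmetric] funpow_commute[where a = ?K and b = l])
    then show ?thesis by (simp only: mult.commute[of 2] funpow_fixed_mult)
  qed
qed

lemma has_finite_order_step: "has_finite_order ns \<longleftrightarrow> has_finite_order ns'"
proof
  assume "has_finite_order ns"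
  then obtain N where "0 < N" "\<And>v. (config_elem ns ^^ N) v = v"
    unfolding has_finite_order_def by auto
  with finite_order_descends[of N] show "has_finite_order ns'"
    unfolding has_finite_order_def by auto
next
  assume "has_finite_order ns'"
  then obtain N where "0 < N" "\<And>v. (config_elem ns' ^^ N) v = v"
    unfolding has_finite_order_def by auto
  with finite_order_lifts[of N] show "has_finite_order ns"
    unfolding has_finite_order_def by (intro exI[of _ "2 * ((2 * length cs + 1) * N)"]) simp
qed

end

text \<open>Infinite descent: with \<open>ns\<close> as its own successor, an exponent yields a
  smaller one, the return time being at least 3.\<close>

lemma infinite_order_loop:
  assumes "shift ns = cells_word ns cs" "cs \<noteq> []"
  shows "\<not> has_finite_order ns"
proof
  have "0 < N \<Longrightarrow> \<not> (\<forall>v. (config_elem ns ^^ N) v = v)" for N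
  proof (induction N rule: less_induct)
    case (less N)
    show ?case
    proof
      assume "\<forall>v. (config_elem ns ^^ N) v = v"
      then obtain q where "q > 0" "q * (2 * length cs + 1) = N" "\<forall>v. (config_elem ns ^^ q) v = v"
        using finite_order_descends[OF assms(1)] less.prems by blast
      moreover from this have "N = q + 2 * (q * length cs)" "0 < q * length cs"
        using assms(2) by (auto simp: algebra_simps)
      then have "q < N" by linarith
      ultimately show False using less.IH by blast
    qed
  qed
  moreover assume "has_finite_order ns"
  ultimately show False unfolding has_finite_order_def by blast
qed

end

section \<open>Finiteness and invertibility of the automaton\<close>

lemma alphabet_M [simp]: "alphabet M = letters"
  by (simp add: M_def)

lemma finite_letters: "finite letters"
proof -
  have fin: "finite positions"
    unfolding positions_def by (rule finite_lists_length_eq) simp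
  have "letters \<subseteq> (\<Union>i\<in>positions. \<Union>x\<in>positions. (\<lambda>m. (i, m, x)) ` {..2 * length (chain i)})"
  proof
    fix a assume a: "a \<in> letters"
    obtain i m x where "a = (i, m, x)" by (cases a)
    with lettersE(1-3)[of i m x] a
    show "a \<in> (\<Union>i\<in>positions. \<Union>x\<in>positions. (\<lambda>m. (i, m, x)) ` {..2 * length (chain i)})"
      by auto
  qed
  then show ?thesis by (rule finite_subset) (intro finite_UN_I fin, simp)
qed

lemma sec_states:
  assumes "p \<in> states M" "a \<in> letters"
  shows "sec p a \<in> states M"
proof (cases a)
  case (fields i m x)
  have "target i m < r" if "fires i m j y" for j y
  proof -
    have "chain i ! (m div 2) \<in> set (chain i)"
      using that by (intro nth_mem) (auto simp: fires_def)
    moreover have "delta i = Some (chain i)" using lettersE(4)[of i m x] assms(2) fields by simp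
    ultimately show ?thesis using cells[of i "chain i"] by (metis prod.collapse target_def)
  qed
  then show ?thesis using assms fields by (cases p) (auto simp: M_def)
qed

lemma mealy_automaton_M: "mealy_automaton M"
  using finite_letters sec_states out_letters
  by (auto simp: mealy_automaton_def) (simp_all add: M_def)

fun gen_inv :: "gen \<Rightarrow> gen" where
  "gen_inv (GT j) = GTi j"
| "gen_inv (GTi j) = GT j"
| "gen_inv p = p"

lemma act_gen_inv [simp]: "act (gen_inv p) (act p v) = v"
  by (cases p) simp_all

lemma act_gen_inv' [simp]: "act p (act (gen_inv p) v) = v"
  by (cases p) simp_all

lemma gen_inv_states: "p \<in> states M \<Longrightarrow> gen_inv p \<in> states M"
  by (auto simp: M_def)

lemma act_lists: "v \<in> lists letters \<Longrightarrow> act p v \<in> lists letters"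
  by (induction v arbitrary: p) (auto simp: act_Cons out_letters)

lemma invertible_automaton_M: "invertible_automaton M"
  unfolding invertible_automaton_def alphabet_M
proof
  fix p
  show "bij_betw (act p) (lists letters) (lists letters)"
    by (rule bij_betwI[where g = "act (gen_inv p)"])
      (auto simp: act_lists simp del: in_lists_conv_set)
qed

section \<open>Words representing the elements\<close>

definition config_word :: "nat list \<Rightarrow> gen list" where
  "config_word ns = concat (map (\<lambda>j. replicate (ns ! j) (GT j)) [0..<r]) @ [GU] @
     concat (map (\<lambda>j. replicate (ns ! j) (GTi j)) (rev [0..<r])) @ [GS]"

lemma config_word_states: "config_word ns \<in> lists (states M)"
  by (auto simp: config_word_def M_def)

lemma run_word_replicate: "run_word M (replicate n p) v = (act p ^^ n) v"
  by (induction n) simp_all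

lemma run_word_config_word: "run_word M (config_word ns) = config_elem ns"
proof
  fix v
  have 1: "run_word M (concat (map (\<lambda>j. replicate (ns ! j) (GT j)) js)) w = shift_word js ns w" for js w
    by (induction js) (simp_all add: shift_word_def run_word_replicate)
  have 2: "run_word M (concat (map (\<lambda>j. replicate (ns ! j) (GTi j)) (rev js))) w = unshift_word js ns w" for js w
    by (induction js arbitrary: w) (simp_all add: unshift_word_def run_word_replicate)
  show "run_word M (config_word ns) v = config_elem ns v"
    by (simp add: config_word_def 1 2[of "[0..<r]", simplified] config_elem_def conj_u_def)
qed

lemma act_append_invalid: "a \<notin> letters \<Longrightarrow> act p (v @ a # w) = act p v @ a # w"
  by (induction v arbitrary: p) (simp_all add: act_Cons)

text \<open>The action leaves everything from the first invalid letter on unchanged, so a power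
  fixing all lists over the alphabet fixes all lists.\<close>

lemma has_finite_order_iff:
  "has_finite_order ns \<longleftrightarrow> (\<exists>n>0. \<forall>v\<in>lists letters. (run_word M (config_word ns) ^^ n) v = v)"
proof -
  have "(run_word M ps) (v @ a # w) = run_word M ps v @ a # w" if "a \<notin> letters" for ps v a w
    by (induction ps) (simp_all add: act_append_invalid that)
  then have inv: "(run_word M ps ^^ n) (v @ a # w) = (run_word M ps ^^ n) v @ a # w" if "a \<notin> letters" for ps v a w n
    by (induction n) (simp_all add: that)
  have "(\<forall>v\<in>lists letters. (config_elem ns ^^ n) v = v) \<longleftrightarrow> (\<forall>v. (config_elem ns ^^ n) v = v)" for n
  proof (intro iffI allI)
    fix v assume fixed: "\<forall>v\<in>lists letters. (config_elem ns ^^ n) v = v"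
    show "(config_elem ns ^^ n) v = v"
    proof (cases "v \<in> lists letters")
      case False
      then have "\<exists>a\<in>set v. a \<notin> letters" by auto
      then obtain ys a zs where "v = ys @ a # zs" "a \<notin> letters" "\<forall>y\<in>set ys. y \<in> letters"
        by (auto elim!: split_list_first_propE)
      then show ?thesis using inv[where a = a and ps = "config_word ns" and n = n and v = ys and w = zs] fixed by (auto simp: run_word_config_word)
    qed (use fixed in blast)
  qed auto
  then show ?thesis by (simp add: has_finite_order_def run_word_config_word del: in_lists_conv_set)
qed

definition gen_map :: "gen \<Rightarrow> nat list \<Rightarrow> nat list" where
  "gen_map p = restrict (run (encode_mealy M) (to_nat p)) (lists (alphabet (encode_mealy M)))"

lemma state_maps_M: "state_maps (encode_mealy M) = gen_map ` states M"
  by (auto simp: state_maps_def gen_map_def encode_mealy_def)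

lemma finite_order_config_word:
  "finite_order (generated_group (encode_mealy M))
     (word_value (generated_group (encode_mealy M)) (map gen_map (config_word ns))) \<longleftrightarrow>
   has_finite_order ns"
  using finite_order_encode_mealy[OF invertible_automaton_M config_word_states]
  by (simp add: has_finite_order_iff gen_map_def[abs_def] del: in_lists_conv_set)

lemma automaton_group_M: "automaton_group (generated_group (encode_mealy M))"
  unfolding automaton_group_def
  using mealy_automaton_encode_mealy[OF mealy_automaton_M]
    invertible_automaton_encode_mealy[OF invertible_automaton_M] by blast

lemma finite_state_maps_M: "finite (state_maps (encode_mealy M))"
  using mealy_automaton_M by (simp add: state_maps_M mealy_automaton_def)

text \<open>\<open>GT j\<close> and \<open>GTi j\<close> are mutually inverse, and the other states
  are their own inverses.\<close>

lemma state_maps_M_inv: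
  assumes "s \<in> state_maps (encode_mealy M)"
  shows "inv\<^bsub>generated_group (encode_mealy M)\<^esub> s \<in> state_maps (encode_mealy M)"
proof -
  let ?G = "generated_group (encode_mealy M)" and ?L = "lists (alphabet (encode_mealy M))"
  interpret group ?G
    by (rule group_generated_group[OF invertible_automaton_encode_mealy[OF invertible_automaton_M]])
  obtain p where p: "s = gen_map p" "p \<in> states M" using assms by (auto simp: state_maps_M)
  have sub: "state_maps (encode_mealy M) \<subseteq> carrier ?G"
    by (auto simp: generated_group_def intro: generate.incl)
  have bij: "bij_betw (run (encode_mealy M) (to_nat q)) ?L ?L" if "q \<in> states M" for q
    using invertible_automaton_encode_mealy[OF invertible_automaton_M] that
    by (auto simp: invertible_automaton_def encode_mealy_def)
  have "gen_map (gen_inv p) \<otimes>\<^bsub>?G\<^esub> gen_map p =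
      restrict (run (encode_mealy M) (to_nat (gen_inv p)) \<circ> run (encode_mealy M) (to_nat p)) ?L"
    unfolding gen_map_def using bij p(2) gen_inv_states by (intro mult_generated_group) auto
  also have "\<dots> = \<one>\<^bsub>?G\<^esub>"
    unfolding one_generated_group
    by (rule restrict_ext) (auto simp: lists_alphabet_encode_mealy run_encode_mealy simp del: in_lists_conv_set)
  finally have "inv\<^bsub>?G\<^esub> s = gen_map (gen_inv p)"
    using sub p gen_inv_states[OF p(2)] by (intro inv_equality) (auto simp: state_maps_M)
  then show ?thesis using gen_inv_states[OF p(2)] by (simp add: state_maps_M)
qed

end

section \<open>Programs with registers\<close>

datatype prog = Skip | Inc nat | Dec nat | Seq prog prog | While nat prog

type_synonym mem = "nat \<Rightarrow> nat"

text \<open>The semantics is relational: a diverging program is related to no final memory.\<close>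

primrec exec :: "prog \<Rightarrow> mem \<Rightarrow> mem \<Rightarrow> bool" where
  "exec Skip s t \<longleftrightarrow> t = s"
| "exec (Inc i) s t \<longleftrightarrow> t = s(i := Suc (s i))"
| "exec (Dec i) s t \<longleftrightarrow> t = s(i := s i - 1)"
| "exec (Seq p q) s t \<longleftrightarrow> (\<exists>u. exec p s u \<and> exec q u t)"
| "exec (While i p) s t \<longleftrightarrow> (\<lambda>s t. s i \<noteq> 0 \<and> exec p s t)\<^sup>*\<^sup>* s t \<and> t i = 0"

lemma exec_Seq: "exec p s u \<Longrightarrow> exec q u t \<Longrightarrow> exec (Seq p q) s t"
  by auto

lemma exec_While_0: "s i = 0 \<Longrightarrow> exec (While i p) s s"
  by simp

lemma exec_While_step: "s i \<noteq> 0 \<Longrightarrow> exec p s u \<Longrightarrow> exec (While i p) u t \<Longrightarrow> exec (While i p) s t"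
  by (auto intro: converse_rtranclp_into_rtranclp)

section \<open>Compilation of recursive functions\<close>

definition clear :: "nat \<Rightarrow> prog" where
  "clear i = While i (Dec i)"

lemma exec_clear: "exec (clear i) s (s(i := 0))"
proof (induction "s i" arbitrary: s)
  case 0
  then show ?case using exec_While_0[of s i "Dec i"] by (simp add: clear_def fun_upd_idem)
next
  case (Suc n)
  from Suc(1)[of "s(i := s i - 1)"] Suc(2)
  have "exec (While i (Dec i)) (s(i := s i - 1)) (s(i := 0))" by (simp add: clear_def)
  moreover have "exec (Dec i) s (s(i := s i - 1))" by simp
  ultimately show ?case using Suc(2) exec_While_step[of s i "Dec i"] by (metis clear_def nat.distinct(1))
qed

text \<open>Reading a register empties it, so a second copy is made in \<open>h\<close>, from which
  \<open>i\<close> is restored.\<close>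

definition copy :: "nat \<Rightarrow> nat \<Rightarrow> nat \<Rightarrow> prog" where
  "copy i j h = Seq (clear j) (Seq (clear h)
     (Seq (While i (Seq (Dec i) (Seq (Inc j) (Inc h)))) (While h (Seq (Dec h) (Inc i)))))"

lemma exec_copy:
  assumes "i \<noteq> j" "i \<noteq> h" "j \<noteq> h"
  shows "exec (copy i j h) s (s(j := s i, h := 0))"
proof -
  have 1: "exec (While i (Seq (Dec i) (Seq (Inc j) (Inc h)))) s (s(i := 0, j := s j + s i, h := s h + s i))" for s
  proof (induction "s i" arbitrary: s)
    case 0
    then show ?case using exec_While_0[of s i] assms by (simp add: fun_upd_idem)
  next
    case (Suc n)
    let ?s = "s(i := s i - 1, j := Suc (s j), h := Suc (s h))"
    have "exec (Seq (Dec i) (Seq (Inc j) (Inc h))) s ?s" using assms by simp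
    moreover have "s(i := 0, j := s j + s i, h := s h + s i) = ?s(i := 0, j := ?s j + ?s i, h := ?s h + ?s i)"
      using assms Suc(2) by (auto simp: fun_eq_iff)
    moreover have "n = ?s i" using Suc(2) assms by simp
    ultimately show ?case using Suc(1)[of ?s] Suc(2) exec_While_step[of s i] by (metis nat.distinct(1))
  qed
  have 2: "exec (While h (Seq (Dec h) (Inc i))) s (s(h := 0, i := s i + s h))" for s
  proof (induction "s h" arbitrary: s)
    case 0
    then show ?case using exec_While_0[of s h] by (simp add: fun_upd_idem)
  next
    case (Suc n)
    let ?s = "s(h := s h - 1, i := Suc (s i))"
    have "exec (Seq (Dec h) (Inc i)) s ?s" using assms by simp
    moreover have "s(h := 0, i := s i + s h) = ?s(h := 0, i := ?s i + ?s h)"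
      using assms Suc(2) by (auto simp: fun_eq_iff)
    moreover have "n = ?s h" using Suc(2) assms by simp
    ultimately show ?case using Suc(1)[of ?s] Suc(2) exec_While_step[of s h] by (metis nat.distinct(1))
  qed
  let ?s1 = "s(j := 0)" let ?s2 = "?s1(h := 0)"
  let ?s3 = "?s2(i := 0, j := ?s2 j + ?s2 i, h := ?s2 h + ?s2 i)"
  have "?s3(h := 0, i := ?s3 i + ?s3 h) = s(j := s i, h := 0)"
    using assms by (auto simp: fun_eq_iff)
  moreover have "exec (copy i j h) s (?s3(h := 0, i := ?s3 i + ?s3 h))"
    unfolding copy_def by (rule exec_Seq exec_clear 1 2)+
  ultimately show ?thesis by (simp only:)
qed

text \<open>For \<open>PrimRec\<close>, \<open>b\<close> counts finished rounds,
  \<open>b + 1\<close> holds the current value, \<open>b + 2\<close> the remaining rounds, and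
  \<open>b + 3\<close> takes the new value, since the target must differ from the arguments. For
  \<open>Mu\<close>, \<open>b\<close> is the candidate and \<open>b + 1\<close> the value of
  \<open>f\<close> there.\<close>

fun compile :: "recf \<Rightarrow> nat list \<Rightarrow> nat \<Rightarrow> nat \<Rightarrow> prog"
  and compiles :: "recf list \<Rightarrow> nat list \<Rightarrow> nat \<Rightarrow> nat \<Rightarrow> prog" where
  "compile Zero as d b = clear d"
| "compile Succ as d b = Seq (copy (hd as) d b) (Inc d)"
| "compile (Proj i) as d b = copy (as ! i) d b"
| "compile (Comp f gs) as d b =
     Seq (compiles gs as b (b + length gs)) (compile f [b..<b + length gs] d (b + length gs))"
| "compile (PrimRec f g) as d b =
     Seq (clear b) (Seq (copy (hd as) (b + 2) (b + 3)) (Seq (compile f (tl as) (b + 1) (b + 4))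
     (Seq (While (b + 2)
        (Seq (compile g (b # (b + 1) # tl as) (b + 3) (b + 4))
        (Seq (copy (b + 3) (b + 1) (b + 4)) (Seq (Inc b) (Dec (b + 2))))))
     (copy (b + 1) d (b + 4)))))"
| "compile (Mu f) as d b =
     Seq (clear b) (Seq (compile f (b # as) (b + 1) (b + 2))
     (Seq (While (b + 1) (Seq (Inc b) (compile f (b # as) (b + 1) (b + 2)))) (copy b d (b + 2))))"
| "compiles [] as d b = Skip"
| "compiles (g # gs) as d b = Seq (compile g as d b) (compiles gs as (Suc d) b)"

text \<open>The arguments are read from the registers \<open>as\<close>, the value is left in register \<open>d\<close>,
  and registers from \<open>b\<close> on are scratch space with arbitrary initial contents.\<close>

definition compiled :: "recf \<Rightarrow> bool" where
  "compiled f \<longleftrightarrow> (\<forall>as d b s y. rec_eval f (map s as) y \<longrightarrow> set as \<subseteq> {..<b} - {d} \<longrightarrow> d < b \<longrightarrow>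
     (\<exists>t. exec (compile f as d b) s t \<and> t d = y \<and> (\<forall>i<b. i \<noteq> d \<longrightarrow> t i = s i)))"

lemma compiledD:
  assumes "compiled f" "rec_eval f xs y" "map s as = xs" "set as \<subseteq> {..<b} - {d}" "d < b"
  shows "\<exists>t. exec (compile f as d b) s t \<and> t d = y \<and> (\<forall>i<b. i \<noteq> d \<longrightarrow> t i = s i)"
  using assms unfolding compiled_def by blast

lemma compiled_compiles:
  assumes "\<And>g. g \<in> set gs \<Longrightarrow> compiled g"
    and "list_all2 (\<lambda>g y. rec_eval g (map s as) y) gs ys"
    and "set as \<subseteq> {..<d}" "d + length gs \<le> b"
  shows "\<exists>t. exec (compiles gs as d b) s t \<and> map t [d..<d + length gs] = ys \<and> (\<forall>i<d. t i = s i)"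
  using assms
proof (induction gs arbitrary: ys d s)
  case Nil
  then show ?case by simp
next
  case (Cons g gs)
  then obtain y ys' where ys: "ys = y # ys'" "rec_eval g (map s as) y"
    "list_all2 (\<lambda>g y. rec_eval g (map s as) y) gs ys'"
    by (auto simp: list_all2_Cons1)
  have d: "set as \<subseteq> {..<b} - {d}" "d < b" using Cons.prems(3,4) by auto
  then obtain u where u: "exec (compile g as d b) s u" "u d = y"
    "\<forall>i<b. i \<noteq> d \<longrightarrow> u i = s i"
    using compiledD[OF Cons.prems(1)[of g] ys(2) refl d] by auto
  have eq: "map u as = map s as" using Cons.prems(3,4) u(3) by auto
  have "list_all2 (\<lambda>g y. rec_eval g (map u as) y) gs ys'" using ys(3) by (simp only: eq)
  then have "\<exists>t. exec (compiles gs as (Suc d) b) u t \<and> map t [Suc d..<Suc d + length gs] = ys' \<and> (\<forall>i<Suc d. t i = u i)"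
    using Cons.prems by (intro Cons.IH) auto
  then obtain t where t: "exec (compiles gs as (Suc d) b) u t"
    "map t [Suc d..<Suc d + length gs] = ys'" "\<And>i. i < Suc d \<Longrightarrow> t i = u i" by blast
  have "exec (compiles (g # gs) as d b) s t" using u t by auto
  moreover have "[d..<d + length (g # gs)] = d # [Suc d..<Suc d + length gs]"
    by (simp add: upt_conv_Cons del: upt_Suc)
  then have "map t [d..<d + length (g # gs)] = ys"
    using t(2) t(3)[of d] u(2) ys(1) by (simp del: upt_Suc)
  moreover have "t i = s i" if "i < d" for i using t(3)[of i] u(3) that d(2) by simp
  ultimately show ?case by blast
qed

text \<open>The intermediate values \<open>v\<close> are what the loop invariant for the compiled
  recursion refers to.\<close>

lemma PrimRec_values:
  assumes "rec_eval (PrimRec f g) (n # xs) y"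
  shows "\<exists>v. rec_eval f xs (v 0) \<and> (\<forall>m<n. rec_eval g (m # v m # xs) (v (Suc m))) \<and> v n = (y :: nat)"
  using assms
proof (induction n arbitrary: y)
  case 0
  then have "rec_eval f xs y" by cases simp_all
  then show ?case by (intro exI[of _ "\<lambda>_. y"]) simp
next
  case (Suc n)
  from Suc.prems obtain z where z: "rec_eval (PrimRec f g) (n # xs) z" "rec_eval g (n # z # xs) y"
    by cases auto
  from Suc.IH[OF z(1)] obtain v where v: "rec_eval f xs (v 0)"
    "\<forall>m<n. rec_eval g (m # v m # xs) (v (Suc m))" "v n = z" by blast
  show ?case
    using v z(2) by (intro exI[of _ "v(Suc n := y)"]) (auto simp: less_Suc_eq)
qed

lemma compiled_PrimRec:
  assumes f: "compiled f" and g: "compiled g"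
  shows "compiled (PrimRec f g)"
  unfolding compiled_def
proof (intro allI impI)
  fix as and d b :: nat and s :: mem and y
  assume ev: "rec_eval (PrimRec f g) (map s as) y" and as: "set as \<subseteq> {..<b} - {d}" and d: "d < b"
  obtain a as' where a: "as = a # as'" using ev by (cases as) (auto elim: rec_eval.cases)
  define n where "n = s a"
  define xs where "xs = map s as'"
  from ev obtain v where v: "rec_eval f xs (v 0)"
    "\<And>m. m < n \<Longrightarrow> rec_eval g (m # v m # xs) (v (Suc m))" "v n = y"
    using PrimRec_values[of f g n xs y] a by (auto simp: n_def xs_def)
  let ?body = "Seq (compile g (b # (b + 1) # as') (b + 3) (b + 4))
    (Seq (copy (b + 3) (b + 1) (b + 4)) (Seq (Inc b) (Dec (b + 2))))"
  have as': "set as' \<subseteq> {..<b}" "a < b" using as a by auto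
  \<comment> \<open>Invariant: \<open>m\<close> rounds are done and \<open>n - m\<close>
    remain.\<close>
  have loop: "\<exists>t. exec (While (b + 2) ?body) u t \<and> t (b + 1) = y \<and> (\<forall>i<b. t i = u i)"
    if "u b = m" "u (b + 1) = v m" "u (b + 2) = n - m" "m \<le> n" "map u as' = xs" for u m
    using that
  proof (induction "n - m" arbitrary: u m)
    case 0
    then show ?case using exec_While_0[of u "b + 2"] v(3) by (intro exI[of _ u]) simp
  next
    case (Suc l)
    have "set (b # (b + 1) # as') \<subseteq> {..<b + 4} - {b + 3}" using as' by auto
    moreover have "rec_eval g (map u (b # (b + 1) # as')) (v (Suc m))"
      using v(2)[of m] Suc by simp
    ultimately obtain w where w: "exec (compile g (b # (b + 1) # as') (b + 3) (b + 4)) u w"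
      "w (b + 3) = v (Suc m)" "\<And>i. i < b + 4 \<Longrightarrow> i \<noteq> b + 3 \<Longrightarrow> w i = u i"
      using compiledD[OF g, of "map u (b # (b + 1) # as')" "v (Suc m)" u "b # (b + 1) # as'" "b + 4" "b + 3"]
      by auto
    define w' where "w' = w(b + 1 := w (b + 3), b + 4 := 0)"
    have "exec (copy (b + 3) (b + 1) (b + 4)) w w'"
      unfolding w'_def by (rule exec_copy) auto
    define w'' where "w'' = w'(b := Suc (w' b), b + 2 := w' (b + 2) - 1)"
    have body: "exec ?body u w''"
      using w(1) \<open>exec (copy _ _ _) w w'\<close> unfolding w''_def by auto
    have low: "w'' i = u i" if "i < b" for i
      using w(3)[of i] that by (simp add: w''_def w'_def)
    then have "map w'' as' = xs" using Suc.prems(5) as' by (auto simp: subset_iff)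
    moreover have "w'' b = Suc m" "w'' (b + 1) = v (Suc m)" "w'' (b + 2) = n - Suc m"
      using w Suc.prems by (simp_all add: w''_def w'_def)
    moreover have "l = n - Suc m" "Suc m \<le> n" using Suc.hyps(2) by simp_all
    ultimately obtain t where "exec (While (b + 2) ?body) w'' t" "t (b + 1) = y" "\<forall>i<b. t i = w'' i"
      using Suc.hyps(1)[of "Suc m" w''] by blast
    moreover have "u (b + 2) \<noteq> 0" using Suc by simp
    ultimately have "exec (While (b + 2) ?body) u t" using body by (blast intro: exec_While_step)
    then show ?case using \<open>t (b + 1) = y\<close> \<open>\<forall>i<b. t i = w'' i\<close> low by auto
  qed
  define s1 where "s1 = s(b := 0)"
  define s2 where "s2 = s1(b + 2 := s1 a, b + 3 := 0)"
  have s2: "exec (copy a (b + 2) (b + 3)) s1 s2"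
    unfolding s2_def using as' by (intro exec_copy) auto
  have "map s2 as' = xs" unfolding xs_def using as' by (auto simp: s2_def s1_def)
  moreover have "set as' \<subseteq> {..<b + 4} - {b + 1}" using as' by auto
  ultimately obtain s3 where s3: "exec (compile f as' (b + 1) (b + 4)) s2 s3" "s3 (b + 1) = v 0"
    "\<And>i. i < b + 4 \<Longrightarrow> i \<noteq> b + 1 \<Longrightarrow> s3 i = s2 i"
    using compiledD[OF f v(1), of s2 as' "b + 4" "b + 1"] by auto
  have low: "s3 i = s i" if "i < b" for i using s3(3)[of i] that by (simp add: s2_def s1_def)
  then have "map s3 as' = xs" unfolding xs_def using as' by auto
  moreover have "s3 b = 0" "s3 (b + 2) = n" using s3(3)[of b] s3(3)[of "b + 2"] as' by (simp_all add: s2_def s1_def n_def)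
  ultimately obtain s4 where s4: "exec (While (b + 2) ?body) s3 s4" "s4 (b + 1) = y" "\<forall>i<b. s4 i = s3 i"
    using loop[of s3 0] s3(2) by auto
  define s5 where "s5 = s4(d := s4 (b + 1), b + 4 := 0)"
  have "exec (copy (b + 1) d (b + 4)) s4 s5"
    unfolding s5_def using d by (intro exec_copy) auto
  then have "exec (compile (PrimRec f g) as d b) s s5"
    using exec_clear[of b s] s2 s3(1) s4(1) a unfolding s1_def[symmetric] compile.simps
    by (auto intro!: exec_Seq simp del: exec.simps)
  moreover have "s5 d = y" "\<forall>i<b. i \<noteq> d \<longrightarrow> s5 i = s i"
    using s4 low d by (auto simp: s5_def)
  ultimately show "\<exists>t. exec (compile (PrimRec f g) as d b) s t \<and> t d = y \<and> (\<forall>i<b. i \<noteq> d \<longrightarrow> t i = s i)"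
    by blast
qed

lemma compiled_Mu:
  assumes f: "compiled f"
  shows "compiled (Mu f)"
  unfolding compiled_def
proof (intro allI impI)
  fix as and d b :: nat and s :: mem and y
  assume ev: "rec_eval (Mu f) (map s as) y" and as: "set as \<subseteq> {..<b} - {d}" and d: "d < b"
  define xs where "xs = map s as"
  from ev have v: "rec_eval f (y # xs) 0" "\<And>m. m < y \<Longrightarrow> \<exists>z>0. rec_eval f (m # xs) z"
    unfolding xs_def by (cases, blast)+
  have as': "set as \<subseteq> {..<b}" using as by auto
  let ?f = "compile f (b # as) (b + 1) (b + 2)"
  have f_run: "\<exists>t. exec ?f u t \<and> t (b + 1) = z \<and> (\<forall>i\<le>b. t i = u i)"
    if arg: "rec_eval f (m # xs) z" "u b = m" "map u as = xs" for u m z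
  proof -
    have "map u (b # as) = m # xs" using arg by simp
    moreover have "set (b # as) \<subseteq> {..<b + 2} - {b + 1}" using as' by auto
    ultimately obtain t where "exec ?f u t" "t (b + 1) = z" "\<forall>i<b + 2. i \<noteq> b + 1 \<longrightarrow> t i = u i"
      using compiledD[OF f arg(1), of u "b # as" "b + 2" "b + 1"] by auto
    then show ?thesis by (intro exI[of _ t]) auto
  qed
  \<comment> \<open>Invariant: \<open>b + 1\<close> holds the value of \<open>f\<close> at the
    candidate \<open>m\<close>. By determinism it is nonzero as long as
    \<open>m < y\<close>.\<close>
  have loop: "\<exists>t. exec (While (b + 1) (Seq (Inc b) ?f)) u t \<and> t b = y \<and> (\<forall>i<b. t i = u i)"
    if "u b = m" "rec_eval f (m # xs) (u (b + 1))" "m \<le> y" "map u as = xs" for u m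
    using that
  proof (induction "y - m" arbitrary: u m)
    case 0
    then have "u (b + 1) = 0" using v(1) rec_eval_deterministic by fastforce
    then show ?case using exec_While_0[of u "b + 1"] 0 by (intro exI[of _ u]) simp
  next
    case (Suc l)
    have "u (b + 1) \<noteq> 0" using v(2)[of m] Suc rec_eval_deterministic by fastforce
    let ?u = "u(b := Suc m)"
    have m: "map ?u as = xs" using Suc.prems(4) as' by auto
    have "Suc m = y \<or> Suc m < y" using Suc.hyps(2) by linarith
    then obtain z where z: "rec_eval f (Suc m # xs) z"
      using v(1) v(2)[of "Suc m"] by blast
    from f_run[OF z _ m] obtain w where w: "exec ?f ?u w" "w (b + 1) = z" "\<forall>i\<le>b. w i = ?u i" by auto
    have "map w as = xs" using w(3) m as' by (auto simp: subset_iff less_imp_le_nat)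
    moreover have "w b = Suc m" "rec_eval f (Suc m # xs) (w (b + 1))" using w z by simp_all
    moreover have "l = y - Suc m" "Suc m \<le> y" using Suc.hyps(2) by simp_all
    ultimately obtain t where t: "exec (While (b + 1) (Seq (Inc b) ?f)) w t" "t b = y" "\<forall>i<b. t i = w i"
      using Suc.hyps(1)[of "Suc m" w] by blast
    have "exec (Seq (Inc b) ?f) u w" using w(1) Suc.prems(1) by auto
    with t(1) \<open>u (b + 1) \<noteq> 0\<close> have "exec (While (b + 1) (Seq (Inc b) ?f)) u t"
      by (blast intro: exec_While_step)
    then show ?case using t w(3) by auto
  qed
  define s1 where "s1 = s(b := 0)"
  have m1: "map s1 as = xs" unfolding xs_def using as' by (auto simp: s1_def)
  obtain z where z: "rec_eval f (0 # xs) z" using v by (cases "y = 0") auto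
  from f_run[OF z _ m1] obtain s2 where s2: "exec ?f s1 s2" "s2 (b + 1) = z" "\<forall>i\<le>b. s2 i = s1 i"
    by (auto simp: s1_def)
  have "map s2 as = xs" using m1 s2(3) as' by (auto simp: subset_iff less_imp_le_nat)
  moreover have "s2 b = 0" using s2(3) by (simp add: s1_def)
  ultimately obtain s3 where s3: "exec (While (b + 1) (Seq (Inc b) ?f)) s2 s3" "s3 b = y" "\<forall>i<b. s3 i = s2 i"
    using loop[of s2 0] z s2(2) by auto
  define s4 where "s4 = s3(d := s3 b, b + 2 := 0)"
  have "exec (copy b d (b + 2)) s3 s4"
    unfolding s4_def using d by (intro exec_copy) auto
  then have "exec (compile (Mu f) as d b) s s4"
    using exec_clear[of b s] s2 s3(1) unfolding s1_def[symmetric] compile.simps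
    by (auto intro!: exec_Seq simp del: exec.simps)
  moreover have "s4 d = y" "\<forall>i<b. i \<noteq> d \<longrightarrow> s4 i = s i"
    using s3 s2(3) d by (auto simp: s4_def s1_def)
  ultimately show "\<exists>t. exec (compile (Mu f) as d b) s t \<and> t d = y \<and> (\<forall>i<b. i \<noteq> d \<longrightarrow> t i = s i)"
    by blast
qed

theorem compile_correct: "compiled f"
proof (induction f)
  case Zero
  have "y = 0" if "rec_eval Zero xs y" for xs y using that by cases
  then show ?case unfolding compiled_def using exec_clear by (fastforce simp del: exec.simps)
next
  case Succ
  show ?case unfolding compiled_def
  proof (intro allI impI)
    fix as and d b :: nat and s :: mem and y assume ev: "rec_eval Succ (map s as) y" "set as \<subseteq> {..<b} - {d}" "d < b"
    from ev(1) obtain a where a: "as = [a]" "y = Suc (s a)" by cases auto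
    have "exec (copy a d b) s (s(d := s a, b := 0))" using a ev by (intro exec_copy) auto
    then have "exec (compile Succ as d b) s (s(d := Suc (s a), b := 0))"
      using a ev by (auto simp: fun_upd_twist intro!: exI[of _ "s(d := s a, b := 0)"])
    then show "\<exists>t. exec (compile Succ as d b) s t \<and> t d = y \<and> (\<forall>i<b. i \<noteq> d \<longrightarrow> t i = s i)"
      using a ev by (intro exI[of _ "s(d := Suc (s a), b := 0)"]) simp
  qed
next
  case (Proj j)
  show ?case unfolding compiled_def
  proof (intro allI impI)
    fix as and d b :: nat and s :: mem and y assume ev: "rec_eval (Proj j) (map s as) y" "set as \<subseteq> {..<b} - {d}" "d < b"
    from ev(1) have j: "j < length as" "y = s (as ! j)" by (cases, auto)+
    then have "as ! j \<in> {..<b} - {d}" using ev(2) nth_mem by blast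
    then have "exec (copy (as ! j) d b) s (s(d := s (as ! j), b := 0))" using ev by (intro exec_copy) auto
    then show "\<exists>t. exec (compile (Proj j) as d b) s t \<and> t d = y \<and> (\<forall>i<b. i \<noteq> d \<longrightarrow> t i = s i)"
      using j ev by (intro exI[of _ "s(d := s (as ! j), b := 0)"]) simp
  qed
next
  case (Comp f gs)
  show ?case unfolding compiled_def
  proof (intro allI impI)
    fix as and d b :: nat and s :: mem and y assume ev: "rec_eval (Comp f gs) (map s as) y" "set as \<subseteq> {..<b} - {d}" "d < b"
    from ev(1) obtain ys where ys: "list_all2 (\<lambda>g y. rec_eval g (map s as) y) gs ys" "rec_eval f ys y"
      by cases auto
    have "set as \<subseteq> {..<b}" using ev(2) by auto
    then obtain u where u: "exec (compiles gs as b (b + length gs)) s u"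
      "map u [b..<b + length gs] = ys" "\<forall>i<b. u i = s i"
      using compiled_compiles[OF Comp.IH(2) ys(1), of b "b + length gs"] by auto
    have "set [b..<b + length gs] \<subseteq> {..<b + length gs} - {d}" "d < b + length gs" using ev(3) by auto
    with compiledD[OF Comp.IH(1) ys(2) u(2)] obtain t where
      "exec (compile f [b..<b + length gs] d (b + length gs)) u t" "t d = y"
      "\<forall>i<b + length gs. i \<noteq> d \<longrightarrow> t i = u i" by blast
    with u show "\<exists>t. exec (compile (Comp f gs) as d b) s t \<and> t d = y \<and> (\<forall>i<b. i \<noteq> d \<longrightarrow> t i = s i)"
      by (intro exI[of _ t]) auto
  qed
next
  case (PrimRec f g)
  then show ?case by (rule compiled_PrimRec)
next
  case (Mu f)
  then show ?case by (rule compiled_Mu)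
qed

section \<open>An interpreter with six stacks\<close>

definition top_digit :: "nat list \<Rightarrow> nat" where
  "top_digit xs = (case xs of [] \<Rightarrow> 0 | x # _ \<Rightarrow> x)"

lemma top_digit_simps [simp]: "top_digit [] = 0" "top_digit (x # xs) = x"
  by (simp_all add: top_digit_def)

lemma Cons_tl_top [simp]: "top_digit xs = Suc n \<Longrightarrow> Suc n # tl xs = xs"
  by (cases xs) simp_all

text \<open>Puts a visible entry back; the mark 0 of an empty stack must not become an
  entry.\<close>

definition keep :: "nat \<Rightarrow> nat list" where
  "keep x = (if x = 0 then [] else [x])"

lemma keep_simps [simp]:
  "keep 0 = []" "keep (Suc n) = [Suc n]" "keep (numeral m) = [numeral m]"
  by (simp_all add: keep_def)

lemma keep_top [simp]: "0 \<notin> set xs \<Longrightarrow> keep (top_digit xs) @ tl xs = xs"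
  by (cases xs) (auto simp: keep_def)

text \<open>The six stacks hold the state, the program to the left (\<open>a\<close>) and right (\<open>b\<close>) of the
  instruction pointer, the bracket depth \<open>d\<close> in unary, and the registers to the left (\<open>x\<close>) and
  right (\<open>y\<close>) of a head, each register as a block of ones closed by a \<open>2\<close>. The machine sees only
  the top_digit entries, with \<open>0\<close> for an empty stack, and replaces each of them by a word. The tokens
  \<open>1\<close> to \<open>6\<close> move the head right or left, increment, decrement, and open or close a loop. State
  \<open>1\<close> executes a token, \<open>2\<close> and \<open>3\<close> carry a block across the head, \<open>4\<close> and \<open>5\<close> search for
  the matching bracket. After the program, the machine loops if the register at the head is nonzero,
  and halts otherwise.\<close>

fun interpreter :: "nat list \<Rightarrow> nat list list option" where
  "interpreter [q, a, b, d, x, y] =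
    (if q = 1 then
       if b = 0 then (if y = 1 then Some [[1], keep a, [], keep d, keep x, keep y] else None)
       else if b = 1 then Some [[2], 1 # keep a, [], keep d, 2 # keep x, keep y]
       else if b = 2 then Some [[3], 2 # keep a, [], keep d, keep x, 2 # keep y]
       else if b = 3 then Some [[1], 3 # keep a, [], keep d, keep x, if y = 1 then [1, 1] else [1, 2]]
       else if b = 4 then Some [[1], 4 # keep a, [], keep d, keep x, if y = 1 then [] else keep y]
       else if b = 5 then Some [[if y = 1 then 1 else 4], 5 # keep a, [], keep d, keep x, keep y]
       else if y = 1 then Some [[5], keep a, [6], keep d, keep x, keep y]
       else Some [[1], 6 # keep a, [], keep d, keep x, keep y]
     else if q = 2 then
       if y = 1 then Some [[2], keep a, keep b, keep d, 1 # keep x, []]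
       else Some [[1], keep a, keep b, keep d, keep x, []]
     else if q = 3 then
       if x = 1 then Some [[3], keep a, keep b, keep d, [], 1 # keep y]
       else Some [[1], keep a, keep b, keep d, [], keep y]
     else if q = 4 then
       if b = 0 then None
       else if b = 5 then Some [[4], 5 # keep a, [], 1 # keep d, keep x, keep y]
       else if b = 6 \<and> d = 0 then Some [[1], 6 # keep a, [], [], keep x, keep y]
       else Some [[4], b # keep a, [], if b = 6 then [] else keep d, keep x, keep y]
     else
       if a = 0 then None
       else if a = 6 then Some [[5], [], 6 # keep b, 1 # keep d, keep x, keep y]
       else if a = 5 \<and> d = 0 then Some [[1], [5], keep b, [], keep x, keep y]
       else Some [[5], [], a # keep b, if a = 5 then [] else keep d, keep x, keep y])"
| "interpreter _ = None"

definition update :: "nat list list \<Rightarrow> nat list list \<Rightarrow> nat list list" where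
  "update ps ss = map2 (\<lambda>p s. p @ tl s) ps ss"

definition machine_step :: "nat list list \<Rightarrow> nat list list option" where
  "machine_step ss = map_option (\<lambda>ps. update ps ss) (interpreter (map top_digit ss))"

abbreviation reach :: "nat list list \<Rightarrow> nat list list \<Rightarrow> bool" where
  "reach \<equiv> (\<lambda>s t. machine_step s = Some t)\<^sup>*\<^sup>*"

lemma reach_step: "machine_step s = Some t \<Longrightarrow> reach t u \<Longrightarrow> reach s u"
  by (rule converse_rtranclp_into_rtranclp)

lemma reach_trans: "reach s t \<Longrightarrow> reach t u \<Longrightarrow> reach s u"
  by (rule rtranclp_trans)

section \<open>Programs as words of tokens\<close>

primrec code :: "prog \<Rightarrow> nat list" where
  "code Skip = []"
| "code (Inc i) = replicate i 1 @ 3 # replicate i 2"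
| "code (Dec i) = replicate i 1 @ 4 # replicate i 2"
| "code (Seq p q) = code p @ code q"
| "code (While i p) = replicate i 1 @ 5 # replicate i 2 @ code p @ replicate i 1 @ 6 # replicate i 2"

lemma set_code: "set (code p) \<subseteq> {1..6}"
  by (induction p) auto

text \<open>An entry 0 would be indistinguishable from the end of the stack.\<close>

definition word_ok :: "nat list \<Rightarrow> bool" where
  "word_ok w \<longleftrightarrow> 0 \<notin> set w"

lemma word_ok_simps [simp]:
  "word_ok []" "word_ok (x # w) \<longleftrightarrow> x \<noteq> 0 \<and> word_ok w"
  "word_ok (v @ w) \<longleftrightarrow> word_ok v \<and> word_ok w" "word_ok (rev w) \<longleftrightarrow> word_ok w"
  "word_ok (replicate n x) \<longleftrightarrow> n = 0 \<or> x \<noteq> 0"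
  by (auto simp: word_ok_def)

lemma keep_top_ok [simp]: "word_ok w \<Longrightarrow> keep (top_digit w) @ tl w = w"
  by (simp add: word_ok_def)

lemma word_ok_code [simp]: "word_ok (code p)"
  using set_code[of p] by (auto simp: word_ok_def)

lemmas step_simps = machine_step_def update_def

section \<open>Bracket search\<close>

text \<open>Balance is expressed by the machine itself: both searching states cross \<open>w\<close>
  and restore the depth, whatever it is.\<close>

definition balanced :: "nat list \<Rightarrow> bool" where
  "balanced w \<longleftrightarrow> word_ok w \<and>
     (\<forall>a b n x y. word_ok a \<longrightarrow> word_ok b \<longrightarrow> word_ok x \<longrightarrow> word_ok y \<longrightarrow>
        reach [[4], a, w @ b, replicate n 1, x, y] [[4], rev w @ a, b, replicate n 1, x, y] \<and>
        reach [[5], rev w @ a, b, replicate n 1, x, y] [[5], a, w @ b, replicate n 1, x, y])"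

lemma keep_top_replicate [simp]:
  "keep (top_digit (replicate n (Suc 0))) @ replicate (n - Suc 0) (Suc 0) = replicate n (Suc 0)"
  by (cases n) (auto simp: keep_def)

lemma balanced_Nil: "balanced []"
  by (simp add: balanced_def)

lemma balanced_append:
  assumes "balanced v" "balanced w"
  shows "balanced (v @ w)"
  unfolding balanced_def
proof (intro conjI allI impI)
  show "word_ok (v @ w)" using assms by (simp add: balanced_def)
  fix a b n x y
  assume "word_ok a" "word_ok b" "word_ok x" "word_ok y"
  moreover have "word_ok v" "word_ok w" using assms by (simp_all add: balanced_def)
  ultimately have
    "reach [[4], a, v @ w @ b, replicate n 1, x, y] [[4], rev v @ a, w @ b, replicate n 1, x, y]"
    "reach [[4], rev v @ a, w @ b, replicate n 1, x, y] [[4], rev w @ rev v @ a, b, replicate n 1, x, y]"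
    "reach [[5], rev w @ rev v @ a, b, replicate n 1, x, y] [[5], rev v @ a, w @ b, replicate n 1, x, y]"
    "reach [[5], rev v @ a, w @ b, replicate n 1, x, y] [[5], a, v @ w @ b, replicate n 1, x, y]"
    using assms unfolding balanced_def by simp_all
  then show "reach [[4], a, (v @ w) @ b, replicate n 1, x, y] [[4], rev (v @ w) @ a, b, replicate n 1, x, y]"
    "reach [[5], rev (v @ w) @ a, b, replicate n 1, x, y] [[5], a, (v @ w) @ b, replicate n 1, x, y]"
    by (auto intro: reach_trans)
qed

lemma balanced_single:
  assumes "t \<in> {1, 2, 3, 4}"
  shows "balanced [t]"
proof -
  have "machine_step [[4], a, t # b, d, x, y] = Some [[4], t # a, b, d, x, y]"
    "machine_step [[5], t # a, b, d, x, y] = Some [[5], a, t # b, d, x, y]"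
    if "word_ok a" "word_ok b" "word_ok d" "word_ok x" "word_ok y" for a b d x y
    using assms that by (auto simp: step_simps)
  then show ?thesis using assms unfolding balanced_def by auto
qed

lemma balanced_replicate: "t \<in> {1, 2, 3, 4} \<Longrightarrow> balanced (replicate n t)"
  by (induction n) (use balanced_Nil balanced_append[OF balanced_single] in auto)

text \<open>The bracket met first raises the depth to \<open>Suc n\<close>, so its partner is not
  mistaken for the bracket sought, even if \<open>n = 0\<close>.\<close>

lemma balanced_bracket:
  assumes w: "balanced w"
  shows "balanced (5 # w @ [6])"
  unfolding balanced_def
proof (intro conjI allI impI)
  have ok: "word_ok w" using w by (simp add: balanced_def)
  then show "word_ok (5 # w @ [6])" by simp
  fix a b n x y
  assume ok': "word_ok a" "word_ok b" "word_ok x" "word_ok y"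
  have "machine_step [[4], a, 5 # w @ 6 # b, replicate n 1, x, y] =
      Some [[4], 5 # a, w @ 6 # b, replicate (Suc n) 1, x, y]"
    "machine_step [[4], rev w @ 5 # a, 6 # b, replicate (Suc n) 1, x, y] =
      Some [[4], 6 # rev w @ 5 # a, b, replicate n 1, x, y]"
    "machine_step [[5], 6 # rev w @ 5 # a, b, replicate n 1, x, y] =
      Some [[5], rev w @ 5 # a, 6 # b, replicate (Suc n) 1, x, y]"
    "machine_step [[5], 5 # a, w @ 6 # b, replicate (Suc n) 1, x, y] =
      Some [[5], a, 5 # w @ 6 # b, replicate n 1, x, y]"
    using ok ok' by (auto simp: step_simps)
  moreover have
    "reach [[4], 5 # a, w @ 6 # b, replicate (Suc n) 1, x, y] [[4], rev w @ 5 # a, 6 # b, replicate (Suc n) 1, x, y]"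
    "reach [[5], rev w @ 5 # a, 6 # b, replicate (Suc n) 1, x, y] [[5], 5 # a, w @ 6 # b, replicate (Suc n) 1, x, y]"
    using w ok' unfolding balanced_def by (simp_all del: replicate_Suc)
  ultimately show
    "reach [[4], a, (5 # w @ [6]) @ b, replicate n 1, x, y] [[4], rev (5 # w @ [6]) @ a, b, replicate n 1, x, y]"
    "reach [[5], rev (5 # w @ [6]) @ a, b, replicate n 1, x, y] [[5], a, (5 # w @ [6]) @ b, replicate n 1, x, y]"
    by (auto intro: reach_step reach_trans simp del: replicate_Suc)
qed

lemma balanced_code: "balanced (code p)"
proof (induction p)
  case (While i p)
  have "balanced (replicate i 2 @ code p @ replicate i 1)"
    by (intro balanced_append balanced_replicate While) auto
  from balanced_append[OF balanced_replicate balanced_append[OF balanced_bracket[OF this] balanced_replicate], of 1 2 i i]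
  show ?case by simp
next
  case (Inc i)
  have "balanced (replicate i 1 @ [3] @ replicate i 2)"
    by (intro balanced_append balanced_replicate balanced_single) auto
  then show ?case by simp
next
  case (Dec i)
  have "balanced (replicate i 1 @ [4] @ replicate i 2)"
    by (intro balanced_append balanced_replicate balanced_single) auto
  then show ?case by simp
qed (simp_all add: balanced_Nil balanced_append)

section \<open>Registers on the two tape stacks\<close>

definition block :: "nat \<Rightarrow> nat list" where
  "block n = replicate n 1 @ [2]"

definition left_tape :: "mem \<Rightarrow> nat \<Rightarrow> nat list" where
  "left_tape s h = concat (map (\<lambda>i. block (s i)) (rev [0..<h]))"

definition right_tape :: "mem \<Rightarrow> nat \<Rightarrow> nat \<Rightarrow> nat list" where
  "right_tape s h n = concat (map (\<lambda>i. block (s i)) [h..<n])"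

text \<open>A relation, because the right stack may end anywhere after the last nonzero register;
  missing registers count as 0.\<close>

definition tape :: "mem \<Rightarrow> nat \<Rightarrow> nat list \<Rightarrow> bool" where
  "tape s h y \<longleftrightarrow> (\<exists>n. y = right_tape s h n \<and> (\<forall>i\<ge>n. s i = 0))"

lemma word_ok_block [simp]: "word_ok (block n)"
  by (simp add: block_def)

lemma word_ok_concat [simp]: "word_ok (concat ws) \<longleftrightarrow> (\<forall>w\<in>set ws. word_ok w)"
  by (induction ws) auto

lemma word_ok_left_tape [simp]: "word_ok (left_tape s h)"
  by (simp add: left_tape_def)

lemma word_ok_tape: "tape s h y \<Longrightarrow> word_ok y"
  by (auto simp: tape_def right_tape_def)

lemma left_tape_Suc: "left_tape s (Suc h) = block (s h) @ left_tape s h"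
  by (simp add: left_tape_def)

lemma left_tape_upd [simp]: "h \<le> i \<Longrightarrow> left_tape (s(i := x)) h = left_tape s h"
  by (auto simp: left_tape_def intro!: arg_cong[of _ _ concat])

lemma right_tape_upd [simp]: "i < h \<Longrightarrow> right_tape (s(i := x)) h n = right_tape s h n"
  by (auto simp: right_tape_def intro!: arg_cong[of _ _ concat])

lemma right_tape_less: "h < n \<Longrightarrow> right_tape s h n = block (s h) @ right_tape s (Suc h) n"
  by (simp add: right_tape_def upt_conv_Cons)

lemma right_tape_ge: "n \<le> h \<Longrightarrow> right_tape s h n = []"
  by (simp add: right_tape_def)

text \<open>The register at the head is either present as a block or lies past the end of the stack;
  in the latter case writing creates its block.\<close>

lemma tape_cases:
  assumes "tape s h y"
  obtains (block) z where "y = block (s h) @ z" "tape s (Suc h) z"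
    "\<And>x. tape (s(h := x)) h (block x @ z)"
  | (empty) "y = []" "s h = 0" "tape s (Suc h) []" "\<And>x. tape (s(h := x)) h (block x)"
proof -
  from assms obtain n where n: "y = right_tape s h n" "\<forall>i\<ge>n. s i = 0" by (auto simp: tape_def)
  show ?thesis
  proof (cases "h < n")
    case True
    have "tape (s(h := x)) h (block x @ right_tape s (Suc h) n)" for x
      unfolding tape_def using True n by (intro exI[of _ n]) (auto simp: right_tape_less)
    then show ?thesis
      using n True by (intro block[of "right_tape s (Suc h) n"]) (auto simp: right_tape_less tape_def)
  next
    case False
    then have "tape (s(h := x)) h (block x)" for x
      unfolding tape_def using n
      by (intro exI[of _ "Suc h"]) (auto simp: right_tape_less right_tape_ge)
    moreover have "tape s (Suc h) []" unfolding tape_def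
      using False n by (intro exI[of _ n]) (auto simp: right_tape_ge)
    ultimately show ?thesis using False n by (intro empty) (auto simp: right_tape_ge)
  qed
qed

lemma tape_block: "tape s (Suc h) z \<Longrightarrow> tape s h (block (s h) @ z)"
proof -
  assume "tape s (Suc h) z"
  then obtain n where n: "z = right_tape s (Suc h) n" "\<forall>i\<ge>n. s i = 0" by (auto simp: tape_def)
  show ?thesis unfolding tape_def
  proof (cases "h < n")
    case True
    then show "\<exists>n. block (s h) @ z = right_tape s h n \<and> (\<forall>i\<ge>n. s i = 0)"
      using n by (intro exI[of _ n]) (auto simp: right_tape_less)
  next
    case False
    then show "\<exists>n. block (s h) @ z = right_tape s h n \<and> (\<forall>i\<ge>n. s i = 0)"
      using n by (intro exI[of _ "Suc h"]) (auto simp: right_tape_less right_tape_ge)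
  qed
qed

lemma tape_top: "tape s h y \<Longrightarrow> top_digit y = 1 \<longleftrightarrow> s h \<noteq> 0"
  by (erule tape_cases) (cases "s h"; simp add: block_def)+

section \<open>Simulation of program execution\<close>

text \<open>Accepting every representation \<open>y\<close> and returning some \<open>y'\<close>
  makes runs composable although representations are not unique.\<close>

definition runs :: "nat list \<Rightarrow> nat list \<Rightarrow> mem \<Rightarrow> nat \<Rightarrow> nat list \<Rightarrow> nat list \<Rightarrow> mem \<Rightarrow> nat \<Rightarrow> bool" where
  "runs a b s h a' b' s' h' \<longleftrightarrow> (\<forall>y. tape s h y \<longrightarrow>
     (\<exists>y'. reach [[1], a, b, [], left_tape s h, y] [[1], a', b', [], left_tape s' h', y'] \<and> tape s' h' y'))"

lemma runs_refl: "runs a b s h a b s h"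
  by (auto simp: runs_def)

lemma runs_trans:
  assumes "runs a b s h a' b' s' h'" "runs a' b' s' h' a'' b'' s'' h''"
  shows "runs a b s h a'' b'' s'' h''"
  unfolding runs_def
proof (intro allI impI)
  fix y assume "tape s h y"
  then obtain y' where y': "reach [[1], a, b, [], left_tape s h, y] [[1], a', b', [], left_tape s' h', y']"
    "tape s' h' y'" using assms(1) unfolding runs_def by blast
  then obtain y'' where "reach [[1], a', b', [], left_tape s' h', y'] [[1], a'', b'', [], left_tape s'' h'', y'']"
    "tape s'' h'' y''" using assms(2) unfolding runs_def by blast
  with y'(1) show "\<exists>y'. reach [[1], a, b, [], left_tape s h, y] [[1], a'', b'', [], left_tape s'' h'', y'] \<and> tape s'' h'' y'"
    by (blast intro: reach_trans)
qed

lemma runs_right: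
  assumes "word_ok a" "word_ok b"
  shows "runs a (1 # b) s h (1 # a) b s (Suc h)"
  unfolding runs_def
proof (intro allI impI)
  fix y assume y: "tape s h y"
  \<comment> \<open>State \<open>2\<close> carries the ones across and drops the closing entry, if
    there is one; the \<open>2\<close> closing the block on the left was pushed beforehand.\<close>
  have move: "reach [[2], 1 # a, b, [], x, replicate n 1 @ z] [[1], 1 # a, b, [], replicate n 1 @ x, tl z]"
    if "word_ok x" "word_ok z" "top_digit z \<noteq> 1" for n x z
    using that
  proof (induction n arbitrary: x)
    case 0
    then have "machine_step [[2], 1 # a, b, [], x, z] = Some [[1], 1 # a, b, [], x, tl z]"
      using assms by (auto simp: step_simps)
    then show ?case by (auto intro: reach_step)
  next
    case (Suc n)
    then have "machine_step [[2], 1 # a, b, [], x, 1 # replicate n 1 @ z] =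
        Some [[2], 1 # a, b, [], 1 # x, replicate n 1 @ z]"
      using assms by (auto simp: step_simps)
    moreover have "reach [[2], 1 # a, b, [], 1 # x, replicate n 1 @ z] [[1], 1 # a, b, [], replicate n 1 @ 1 # x, tl z]"
      using Suc by simp
    ultimately show ?case by (auto intro: reach_step simp: replicate_app_Cons_same)
  qed
  have step: "machine_step [[1], a, 1 # b, [], left_tape s h, y] = Some [[2], 1 # a, b, [], 2 # left_tape s h, y]"
    using assms word_ok_tape[OF y] by (auto simp: step_simps)
  show "\<exists>y'. reach [[1], a, 1 # b, [], left_tape s h, y] [[1], 1 # a, b, [], left_tape s (Suc h), y'] \<and> tape s (Suc h) y'"
    using y
  proof (cases rule: tape_cases)
    case (block z)
    then have "reach [[2], 1 # a, b, [], 2 # left_tape s h, y] [[1], 1 # a, b, [], replicate (s h) 1 @ 2 # left_tape s h, z]"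
      using move[of "2 # left_tape s h" "2 # z" "s h"] word_ok_tape[OF y] by (auto simp: block_def)
    with block step show ?thesis
      by (intro exI[of _ z]) (auto simp: left_tape_Suc block_def intro: reach_step)
  next
    case empty
    then have "reach [[2], 1 # a, b, [], 2 # left_tape s h, y] [[1], 1 # a, b, [], 2 # left_tape s h, []]"
      using move[of "2 # left_tape s h" "[]" 0] by auto
    with empty step show ?thesis
      by (intro exI[of _ "[]"]) (auto simp: left_tape_Suc block_def intro: reach_step)
  qed
qed

lemma runs_left:
  assumes "word_ok a" "word_ok b"
  shows "runs a (2 # b) s (Suc h) (2 # a) b s h"
  unfolding runs_def
proof (intro allI impI)
  fix y assume y: "tape s (Suc h) y"
  have move: "reach [[3], 2 # a, b, [], replicate n 1 @ 2 # x, z] [[1], 2 # a, b, [], x, replicate n 1 @ z]"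
    if "word_ok x" "word_ok z" for n x z
    using that
  proof (induction n arbitrary: z)
    case 0
    then have "machine_step [[3], 2 # a, b, [], 2 # x, z] = Some [[1], 2 # a, b, [], x, z]"
      using assms by (auto simp: step_simps)
    then show ?case by (auto intro: reach_step)
  next
    case (Suc n)
    then have "machine_step [[3], 2 # a, b, [], 1 # replicate n 1 @ 2 # x, z] =
        Some [[3], 2 # a, b, [], replicate n 1 @ 2 # x, 1 # z]"
      using assms by (auto simp: step_simps)
    moreover have "reach [[3], 2 # a, b, [], replicate n 1 @ 2 # x, 1 # z] [[1], 2 # a, b, [], x, replicate n 1 @ 1 # z]"
      using Suc by simp
    ultimately show ?case by (auto intro: reach_step simp: replicate_app_Cons_same)
  qed
  have "machine_step [[1], a, 2 # b, [], left_tape s (Suc h), y] = Some [[3], 2 # a, b, [], left_tape s (Suc h), 2 # y]"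
    using assms word_ok_tape[OF y] by (auto simp: step_simps)
  moreover have "reach [[3], 2 # a, b, [], left_tape s (Suc h), 2 # y] [[1], 2 # a, b, [], left_tape s h, block (s h) @ y]"
    using move[of "left_tape s h" "2 # y" "s h"] word_ok_tape[OF y] by (simp add: left_tape_Suc block_def)
  ultimately show "\<exists>y'. reach [[1], a, 2 # b, [], left_tape s (Suc h), y] [[1], 2 # a, b, [], left_tape s h, y'] \<and> tape s h y'"
    using tape_block[OF y] by (blast intro: reach_step)
qed


lemma runs_step:
  assumes "\<And>y. tape s h y \<Longrightarrow> \<exists>y'. machine_step [[1], a, b, [], left_tape s h, y] =
      Some [[1], a', b', [], left_tape s' h', y'] \<and> tape s' h' y'"
  shows "runs a b s h a' b' s' h'"
  unfolding runs_def using assms by (blast intro: reach_step)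

lemma runs_Inc:
  assumes "word_ok a" "word_ok b"
  shows "runs a (3 # b) s h (3 # a) b (s(h := Suc (s h))) h"
proof (rule runs_step)
  fix y assume y: "tape s h y"
  then show "\<exists>y'. machine_step [[1], a, 3 # b, [], left_tape s h, y] =
      Some [[1], 3 # a, b, [], left_tape (s(h := Suc (s h))) h, y'] \<and> tape (s(h := Suc (s h))) h y'"
  proof (cases rule: tape_cases)
    case (block z)
    then show ?thesis using assms block(3)[of "Suc (s h)"] word_ok_tape[OF y]
      by (cases "s h") (auto simp: step_simps block_def)
  next
    case empty
    then show ?thesis using assms empty(4)[of 1] by (auto simp: step_simps block_def)
  qed
qed

lemma runs_Dec:
  assumes "word_ok a" "word_ok b"
  shows "runs a (4 # b) s h (4 # a) b (s(h := s h - 1)) h"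
proof (rule runs_step)
  fix y assume y: "tape s h y"
  then show "\<exists>y'. machine_step [[1], a, 4 # b, [], left_tape s h, y] =
      Some [[1], 4 # a, b, [], left_tape (s(h := s h - 1)) h, y'] \<and> tape (s(h := s h - 1)) h y'"
  proof (cases rule: tape_cases)
    case (block z)
    then show ?thesis using assms block(3)[of "s h - 1"] word_ok_tape[OF y]
      by (cases "s h") (auto simp: step_simps block_def)
  next
    case empty
    then show ?thesis using assms y by (auto simp: step_simps fun_upd_idem)
  qed
qed

lemma runs_open_enter:
  assumes "word_ok a" "word_ok b" "s h \<noteq> 0"
  shows "runs a (5 # b) s h (5 # a) b s h"
proof (rule runs_step)
  fix y assume y: "tape s h y"
  with assms tape_top[OF y] word_ok_tape[OF y]
  show "\<exists>y'. machine_step [[1], a, 5 # b, [], left_tape s h, y] =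
      Some [[1], 5 # a, b, [], left_tape s h, y'] \<and> tape s h y'"
    by (auto simp: step_simps)
qed

lemma runs_close_exit:
  assumes "word_ok a" "word_ok b" "s h = 0"
  shows "runs a (6 # b) s h (6 # a) b s h"
proof (rule runs_step)
  fix y assume y: "tape s h y"
  with assms tape_top[OF y] word_ok_tape[OF y]
  show "\<exists>y'. machine_step [[1], a, 6 # b, [], left_tape s h, y] =
      Some [[1], 6 # a, b, [], left_tape s h, y'] \<and> tape s h y'"
    by (auto simp: step_simps)
qed

text \<open>The search starts at depth 0 and crosses the balanced body at this depth, so it stops at
  the matching bracket.\<close>

lemma runs_open_skip:
  assumes "word_ok a" "word_ok b" "s h = 0" "balanced w"
  shows "runs a (5 # w @ 6 # b) s h (6 # rev w @ 5 # a) b s h"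
  unfolding runs_def
proof (intro allI impI)
  fix y assume y: "tape s h y"
  have ok: "word_ok w" using assms(4) by (simp add: balanced_def)
  have "machine_step [[1], a, 5 # w @ 6 # b, [], left_tape s h, y] = Some [[4], 5 # a, w @ 6 # b, [], left_tape s h, y]"
    using assms ok tape_top[OF y] word_ok_tape[OF y] by (auto simp: step_simps)
  moreover have "reach [[4], 5 # a, w @ 6 # b, replicate 0 1, left_tape s h, y]
      [[4], rev w @ 5 # a, 6 # b, replicate 0 1, left_tape s h, y]"
    using assms word_ok_tape[OF y] unfolding balanced_def by (simp del: replicate_0)
  moreover have "machine_step [[4], rev w @ 5 # a, 6 # b, [], left_tape s h, y] =
      Some [[1], 6 # rev w @ 5 # a, b, [], left_tape s h, y]"
    using assms ok word_ok_tape[OF y] by (auto simp: step_simps)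
  ultimately have "reach [[1], a, 5 # w @ 6 # b, [], left_tape s h, y] [[1], 6 # rev w @ 5 # a, b, [], left_tape s h, y]"
    by (auto intro: reach_step reach_trans)
  with y show "\<exists>y'. reach [[1], a, 5 # w @ 6 # b, [], left_tape s h, y] [[1], 6 # rev w @ 5 # a, b, [], left_tape s h, y'] \<and> tape s h y'"
    by blast
qed

text \<open>The backward search leaves the opening bracket on the left stack, so the body restarts
  without a second test; the closing bracket has already tested the register.\<close>

lemma runs_close_repeat:
  assumes "word_ok a" "word_ok b" "s h \<noteq> 0" "balanced w"
  shows "runs (rev w @ 5 # a) (6 # b) s h (5 # a) (w @ 6 # b) s h"
  unfolding runs_def
proof (intro allI impI)
  fix y assume y: "tape s h y"
  have ok: "word_ok w" using assms(4) by (simp add: balanced_def)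
  have "machine_step [[1], rev w @ 5 # a, 6 # b, [], left_tape s h, y] = Some [[5], rev w @ 5 # a, 6 # b, [], left_tape s h, y]"
    using assms ok tape_top[OF y] word_ok_tape[OF y] by (auto simp: step_simps)
  moreover have "reach [[5], rev w @ 5 # a, 6 # b, replicate 0 1, left_tape s h, y]
      [[5], 5 # a, w @ 6 # b, replicate 0 1, left_tape s h, y]"
    using assms word_ok_tape[OF y] unfolding balanced_def by (simp del: replicate_0)
  moreover have "machine_step [[5], 5 # a, w @ 6 # b, [], left_tape s h, y] =
      Some [[1], 5 # a, w @ 6 # b, [], left_tape s h, y]"
    using assms ok word_ok_tape[OF y] by (auto simp: step_simps)
  ultimately have "reach [[1], rev w @ 5 # a, 6 # b, [], left_tape s h, y] [[1], 5 # a, w @ 6 # b, [], left_tape s h, y]"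
    by (auto intro: reach_step reach_trans)
  with y show "\<exists>y'. reach [[1], rev w @ 5 # a, 6 # b, [], left_tape s h, y] [[1], 5 # a, w @ 6 # b, [], left_tape s h, y'] \<and> tape s h y'"
    by blast
qed

lemma runs_rights:
  assumes "word_ok a" "word_ok b"
  shows "runs a (replicate n 1 @ b) s h (replicate n 1 @ a) b s (n + h)"
  using assms
proof (induction n arbitrary: a h)
  case 0
  then show ?case by (simp add: runs_refl)
next
  case (Suc n)
  have "runs a (1 # replicate n 1 @ b) s h (1 # a) (replicate n 1 @ b) s (Suc h)"
    using Suc.prems by (intro runs_right) auto
  with Suc.IH[of "1 # a" "Suc h"] Suc.prems show ?case
    by (auto intro: runs_trans simp: replicate_app_Cons_same)
qed

lemma runs_lefts:
  assumes "word_ok a" "word_ok b"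
  shows "runs a (replicate n 2 @ b) s (n + h) (replicate n 2 @ a) b s h"
  using assms
proof (induction n arbitrary: a)
  case 0
  then show ?case by (simp add: runs_refl)
next
  case (Suc n)
  have "runs a (2 # replicate n 2 @ b) s (Suc (n + h)) (2 # a) (replicate n 2 @ b) s (n + h)"
    using Suc.prems by (intro runs_left) auto
  with Suc.IH[of "2 # a"] Suc.prems show ?case
    by (auto intro: runs_trans simp: replicate_app_Cons_same)
qed

text \<open>Each code starts and ends with the head at register 0, so codes can be
  concatenated.\<close>

lemma runs_code:
  assumes "exec p s t" "word_ok a" "word_ok b"
  shows "runs a (code p @ b) s 0 (rev (code p) @ a) b t 0"
  using assms
proof (induction p arbitrary: s t a b)
  case Skip
  then show ?case by (simp add: runs_refl)
next
  case (Inc i)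
  have "runs a (replicate i 1 @ 3 # replicate i 2 @ b) s 0 (replicate i 1 @ a) (3 # replicate i 2 @ b) s (i + 0)"
    using Inc.prems by (intro runs_rights) auto
  moreover have "runs (replicate i 1 @ a) (3 # replicate i 2 @ b) s (i + 0) (3 # replicate i 1 @ a) (replicate i 2 @ b) t (i + 0)"
    using Inc.prems runs_Inc[of "replicate i 1 @ a" "replicate i 2 @ b" s i] by simp
  moreover have "runs (3 # replicate i 1 @ a) (replicate i 2 @ b) t (i + 0) (replicate i 2 @ 3 # replicate i 1 @ a) b t 0"
    using Inc.prems by (intro runs_lefts) auto
  ultimately show ?case by (auto intro: runs_trans)
next
  case (Dec i)
  have "runs a (replicate i 1 @ 4 # replicate i 2 @ b) s 0 (replicate i 1 @ a) (4 # replicate i 2 @ b) s (i + 0)"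
    using Dec.prems by (intro runs_rights) auto
  moreover have "runs (replicate i 1 @ a) (4 # replicate i 2 @ b) s (i + 0) (4 # replicate i 1 @ a) (replicate i 2 @ b) t (i + 0)"
    using Dec.prems runs_Dec[of "replicate i 1 @ a" "replicate i 2 @ b" s i] by simp
  moreover have "runs (4 # replicate i 1 @ a) (replicate i 2 @ b) t (i + 0) (replicate i 2 @ 4 # replicate i 1 @ a) b t 0"
    using Dec.prems by (intro runs_lefts) auto
  ultimately show ?case by (auto intro: runs_trans)
next
  case (Seq p q)
  then obtain u where u: "exec p s u" "exec q u t" by auto
  from Seq.IH(1)[OF u(1), of a "code q @ b"] Seq.IH(2)[OF u(2), of "rev (code p) @ a" b] Seq.prems
  show ?case by (auto intro: runs_trans)
next
  case (While i p)
  define w where "w = replicate i 2 @ code p @ replicate i 1"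
  have bal: "balanced w"
    unfolding w_def by (intro balanced_append balanced_replicate balanced_code) auto
  then have ok: "word_ok w" by (simp add: balanced_def)
  define a0 where "a0 = replicate i 1 @ a"
  define b0 where "b0 = replicate i 2 @ b"
  have ok': "word_ok a0" "word_ok b0" using While.prems by (simp_all add: a0_def b0_def)
  \<comment> \<open>The start is just behind the opening bracket with a round still due. The closing
    bracket at the end of the round exits or repeats.\<close>
  have loop: "(s' i \<noteq> 0 \<longrightarrow> runs (5 # a0) (w @ 6 # b0) s' i (6 # rev w @ 5 # a0) b0 t i)"
    if "(\<lambda>s t. s i \<noteq> 0 \<and> exec p s t)\<^sup>*\<^sup>* s' t" "t i = 0" for s'
    using that
  proof (induction rule: converse_rtranclp_induct)
    case base
    then show ?case by simp
  next
    case (step s' u)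
    have "runs (5 # a0) (w @ 6 # b0) s' (i + 0) (replicate i 2 @ 5 # a0) (code p @ replicate i 1 @ 6 # b0) s' 0"
      using ok' runs_lefts[of "5 # a0" "code p @ replicate i 1 @ 6 # b0" i s' 0] by (simp add: w_def)
    moreover have "runs (replicate i 2 @ 5 # a0) (code p @ replicate i 1 @ 6 # b0) s' 0
        (rev (code p) @ replicate i 2 @ 5 # a0) (replicate i 1 @ 6 # b0) u 0"
      using step.hyps(1) ok' by (intro While.IH) auto
    moreover have "runs (rev (code p) @ replicate i 2 @ 5 # a0) (replicate i 1 @ 6 # b0) u 0
        (rev w @ 5 # a0) (6 # b0) u (i + 0)"
      using ok' runs_rights[of "rev (code p) @ replicate i 2 @ 5 # a0" "6 # b0" i u 0] by (simp add: w_def)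
    ultimately have body: "runs (5 # a0) (w @ 6 # b0) s' i (rev w @ 5 # a0) (6 # b0) u i"
      by (auto intro: runs_trans)
    show ?case
    proof (cases "u i = 0")
      case True
      then have "u = t" using step.hyps(2) by (auto elim: converse_rtranclpE)
      have "runs (rev w @ 5 # a0) (6 # b0) u i (6 # rev w @ 5 # a0) b0 u i"
        using ok ok' True by (intro runs_close_exit) auto
      with body show ?thesis unfolding \<open>u = t\<close> by (auto intro: runs_trans)
    next
      case False
      then have "runs (rev w @ 5 # a0) (6 # b0) u i (5 # a0) (w @ 6 # b0) u i"
        using bal ok' by (intro runs_close_repeat) auto
      with body step False show ?thesis by (auto intro: runs_trans)
    qed
  qed
  have "runs a0 (5 # w @ 6 # b0) s i (6 # rev w @ 5 # a0) b0 t i"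
  proof (cases "s i = 0")
    case True
    then have "s = t" using While.prems(1) by (auto elim: converse_rtranclpE)
    with True show ?thesis using ok' bal runs_open_skip by blast
  next
    case False
    then have "runs a0 (5 # w @ 6 # b0) s i (5 # a0) (w @ 6 # b0) s i"
      using ok ok' by (intro runs_open_enter) auto
    with loop[of s] False While.prems(1) show ?thesis by (auto intro: runs_trans)
  qed
  moreover have "runs a (replicate i 1 @ 5 # w @ 6 # b0) s 0 a0 (5 # w @ 6 # b0) s (i + 0)"
    unfolding a0_def using ok ok' While.prems by (intro runs_rights) auto
  moreover have "runs (6 # rev w @ 5 # a0) b0 t (i + 0) (replicate i 2 @ 6 # rev w @ 5 # a0) b t 0"
    unfolding b0_def using ok ok' While.prems by (intro runs_lefts) auto
  ultimately have "runs a (replicate i 1 @ 5 # w @ 6 # b0) s 0 (replicate i 2 @ 6 # rev w @ 5 # a0) b t 0"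
    by (auto intro: runs_trans)
  then show ?case by (simp add: w_def a0_def b0_def)
qed

text \<open>The argument is in register 0 and the value in register 1. The last token moves the head
  to the value, which decides between halting and looping.\<close>

definition program :: "recf \<Rightarrow> nat list" where
  "program f = code (compile f [0] 1 2) @ [1]"

lemma machine_correct:
  assumes "rec_eval f [n] y"
  shows "\<exists>ss. reach [[1], [], program f, [], [], block n] ss \<and>
    (if y = 0 then machine_step ss = None else interpreter (map top_digit ss) \<noteq> None \<and> machine_step ss = Some ss)"
proof -
  define s :: mem where "s = (\<lambda>i. if i = 0 then n else 0)"
  obtain t where t: "exec (compile f [0] 1 2) s t" "t 1 = y"
    using compiledD[OF compile_correct assms, of s "[0]" 2 1] by (auto simp: s_def)
  have "runs [] (code (compile f [0] 1 2) @ [1]) s 0 (rev (code (compile f [0] 1 2)) @ []) [1] t 0"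
    using t(1) by (intro runs_code) auto
  moreover have "runs (rev (code (compile f [0] 1 2)) @ []) [1] t 0 (1 # rev (code (compile f [0] 1 2)) @ []) [] t (Suc 0)"
    by (intro runs_right) auto
  ultimately have "runs [] (program f) s 0 (1 # rev (code (compile f [0] 1 2))) [] t 1"
    by (auto intro: runs_trans simp: program_def)
  moreover have "tape s 0 (block n)"
    unfolding tape_def by (intro exI[of _ 1]) (simp add: s_def right_tape_def)
  moreover have "left_tape s 0 = []" by (simp add: left_tape_def)
  ultimately obtain z where z: "tape t 1 z" "reach [[1], [], program f, [], [], block n]
      [[1], 1 # rev (code (compile f [0] 1 2)), [], [], left_tape t 1, z]"
    unfolding runs_def by auto
  have "word_ok (1 # rev (code (compile f [0] 1 2)))" by simp
  with tape_top[OF z(1)] word_ok_tape[OF z(1)] t(2) show ?thesis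
    by (intro exI[of _ "[[1], 1 # rev (code (compile f [0] 1 2)), [], [], left_tape t 1, z]"] conjI z(2))
      (auto simp: step_simps)
qed

section \<open>Stacks as counters\<close>

locale stack_machine =
  fixes k r :: nat and rule :: "nat list \<Rightarrow> nat list list option"
  assumes k_gt_1: "1 < k" and r_pos: "0 < r"
begin

text \<open>The top is the least significant digit: the residue modulo \<open>k\<close> shows it,
  and division by \<open>k\<close> pops it.\<close>

definition digits :: "nat list \<Rightarrow> nat" where
  "digits w = foldr (\<lambda>d n. d + k * n) w 0"

lemma digits_simps [simp]: "digits [] = 0" "digits (d # w) = d + k * digits w"
  by (simp_all add: digits_def)

lemma digits_append: "digits (v @ w) = digits v + k ^ length v * digits w"
  by (induction v) (simp_all add: algebra_simps)

lemma digits_mod: "set w \<subseteq> {..<k} \<Longrightarrow> digits w mod k = top_digit w"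
  using k_gt_1 by (cases w) simp_all

lemma digits_div: "set w \<subseteq> {..<k} \<Longrightarrow> digits w div k = digits (tl w)"
  using k_gt_1 by (cases w) simp_all

text \<open>Stack \<open>j\<close> receives \<open>digits p\<close> from constant cells, which fire on the first letter of
  counter \<open>0\<close> because the state digit lies between \<open>1\<close> and \<open>k\<close>; the remaining cells
  multiply the popped counter by a power of \<open>k\<close>.\<close>

definition stack_cells :: "nat \<Rightarrow> nat list \<Rightarrow> cell list" where
  "stack_cells j p = replicate (digits p) (0, 0, j) @ replicate (k ^ length p) (j, k - 1, j)"

definition delta :: "nat list \<Rightarrow> cell list option" where
  "delta i = map_option (\<lambda>ps. concat (map (\<lambda>j. stack_cells j (ps ! j)) [0..<r])) (rule i)"

sublocale counter_group k r delta
proof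
  show "0 < k" using k_gt_1 by simp
  fix i cs a v b
  assume "delta i = Some cs" "(a, v, b) \<in> set cs"
  then show "a < r \<and> b < r"
    using r_pos by (auto simp: delta_def stack_cells_def split: if_splits)
qed

text \<open>Leaving residue \<open>k - 1\<close> is a carry.\<close>

lemma count_mod_last: "count_mod (k - 1) n = n div k"
proof (induction n)
  case (Suc n)
  have "n mod k = k - 1 \<longleftrightarrow> Suc n mod k = 0" using k_gt_1 by (auto simp: mod_Suc)
  with Suc show ?case by (auto simp: count_mod_Suc div_Suc)
qed simp

lemma count_mod_first:
  assumes "0 < n" "n < k"
  shows "count_mod 0 n = 1"
proof -
  have "l mod k = l" if "l < n" for l using that assms(2) by simp
  then have "{l. l < n \<and> l mod k = 0} = {l. l < n \<and> l = 0}" by (metis (no_types))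
  also have "\<dots> = {0}" using assms(1) by auto
  finally have "{l. l < n \<and> l mod k = 0} = {0}" .
  then show ?thesis by (simp add: count_mod_def)
qed

section \<open>Machine steps and orders\<close>

definition stacks_ok :: "nat list list \<Rightarrow> bool" where
  "stacks_ok ss \<longleftrightarrow> length ss = r \<and> (\<forall>s\<in>set ss. set s \<subseteq> {..<k}) \<and> (\<exists>q>0. ss ! 0 = [q])"

lemma res_digits: "stacks_ok ss \<Longrightarrow> res (map digits ss) = map top_digit ss"
  by (auto simp: res_def stacks_ok_def digits_mod)

lemma cells_word_replicate: "cells_word ns (replicate n c) = cell_word ns c ^^ n"
  by (induction n) (simp_all add: cells_word_def)

text \<open>Each constant cell fires once. The carry cells together yield
  \<open>k ^ length p\<close> times the popped counter, so the sum is given by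
  \<open>digits_append\<close>.\<close>

lemma cells_word_stack_cells:
  assumes "stacks_ok ss" "j < r"
  shows "cells_word (map digits ss) (stack_cells j p) v = (act (GT j) ^^ digits (p @ tl (ss ! j))) v"
proof -
  have l: "length ss = r" "set (ss ! j) \<subseteq> {..<k}" using assms by (auto simp: stacks_ok_def)
  obtain q where q: "ss ! 0 = [q]" "0 < q" using assms(1) by (auto simp: stacks_ok_def)
  have "q < k" using assms(1) q(1) r_pos nth_mem[of 0 ss] by (force simp: stacks_ok_def)
  then have "cell_word (map digits ss) (0, 0, j) = act (GT j)"
    using l r_pos q count_mod_first[of q] by (simp add: cell_word_def)
  moreover have "cell_word (map digits ss) (j, k - 1, j) = act (GT j) ^^ digits (tl (ss ! j))"
    using l assms(2) by (simp add: cell_word_def count_mod_last[simplified] digits_div)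
  ultimately show ?thesis
    by (simp add: stack_cells_def cells_word_append cells_word_replicate digits_append funpow_add funpow_mult mult.commute)
qed

lemma cells_word_concat:
  assumes "stacks_ok ss" "set js \<subseteq> {..<r}" "\<And>j. j \<in> set js \<Longrightarrow> ns' ! j = digits (ps ! j @ tl (ss ! j))"
  shows "cells_word (map digits ss) (concat (map (\<lambda>j. stack_cells j (ps ! j)) js)) v = shift_word js ns' v"
  using assms(2,3)
proof (induction js arbitrary: v)
  case Nil
  then show ?case by (simp add: cells_word_def shift_word_def)
next
  case (Cons j js)
  then show ?case using cells_word_stack_cells[OF assms(1), of j]
    by (simp add: cells_word_append) (simp add: shift_word_def)
qed

context
  fixes ss ps
  assumes ok: "stacks_ok ss" and rule: "rule (map top_digit ss) = Some ps" and len: "length ps = r"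
begin

text \<open>All cells read the old counters and are grouped by target in the order of the factors of
  \<open>shift\<close>, so the products agree factor by factor.\<close>

lemma shift_update:
  "shift (map digits (update ps ss)) =
     cells_word (map digits ss) (concat (map (\<lambda>j. stack_cells j (ps ! j)) [0..<r]))"
proof
  fix v
  show "shift (map digits (update ps ss)) v =
     cells_word (map digits ss) (concat (map (\<lambda>j. stack_cells j (ps ! j)) [0..<r])) v"
    using len ok by (intro cells_word_concat[symmetric]) (auto simp: update_def stacks_ok_def)
qed

lemma delta_res: "delta (res (map digits ss)) = Some (concat (map (\<lambda>j. stack_cells j (ps ! j)) [0..<r]))"
  using ok rule by (simp add: res_digits delta_def)

lemma has_finite_order_update:
  "has_finite_order (map digits ss) \<longleftrightarrow> has_finite_order (map digits (update ps ss))"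
  using has_finite_order_step[OF _ delta_res shift_update] ok by (simp add: stacks_ok_def)

lemma infinite_order_fixed:
  assumes "update ps ss = ss"
  shows "\<not> has_finite_order (map digits ss)"
proof (rule infinite_order_loop[OF _ delta_res])
  show "length (map digits ss) = r" using ok by (simp add: stacks_ok_def)
  show "shift (map digits ss) = cells_word (map digits ss) (concat (map (\<lambda>j. stack_cells j (ps ! j)) [0..<r]))"
    using shift_update assms by simp
  \<comment> \<open>Every stack contributes at least one carry cell.\<close>
  show "concat (map (\<lambda>j. stack_cells j (ps ! j)) [0..<r]) \<noteq> []"
    using r_pos k_gt_1 by (auto simp: stack_cells_def intro!: bexI[of _ 0])
qed

end

lemma finite_order_halting:
  "stacks_ok ss \<Longrightarrow> rule (map top_digit ss) = None \<Longrightarrow> has_finite_order (map digits ss)"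
  by (rule halting_finite_order) (auto simp: stacks_ok_def[of ss] res_digits delta_def)

end

section \<open>Computable functions\<close>

definition computable :: "(nat \<Rightarrow> nat) \<Rightarrow> bool" where
  "computable h \<longleftrightarrow> (\<exists>f. \<forall>n. rec_eval f [n] (h n))"

lemma computable_comp:
  assumes "computable g" "computable h"
  shows "computable (\<lambda>n. g (h n))"
proof -
  obtain f1 f2 where f: "\<And>n. rec_eval f1 [n] (g n)" "\<And>n. rec_eval f2 [n] (h n)"
    using assms unfolding computable_def by blast
  have "rec_eval (Comp f1 [f2]) [n] (g (h n))" for n
    using f by (intro eval_Comp[where ys = "[h n]"]) auto
  then show ?thesis unfolding computable_def by blast
qed

lemma computable_id: "computable (\<lambda>n. n)"
  unfolding computable_def
proof (intro exI allI)
  fix n show "rec_eval (Proj 0) [n] n" using eval_Proj[of 0 "[n]"] by simp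
qed

lemma computable_Suc: "computable Suc"
  unfolding computable_def by (blast intro: eval_Succ)

lemma computable_const: "computable (\<lambda>_. c)"
proof (induction c)
  case 0
  then show ?case unfolding computable_def by (blast intro: eval_Zero)
next
  case (Suc c)
  from computable_comp[OF computable_Suc this] show ?case .
qed

lemma computable_iterate:
  assumes "computable g" "computable h" "computable l"
  shows "computable (\<lambda>n. (g ^^ l n) (h n))"
proof -
  obtain f1 f2 f3 where f: "\<And>n. rec_eval f1 [n] (g n)" "\<And>n. rec_eval f2 [n] (h n)" "\<And>n. rec_eval f3 [n] (l n)"
    using assms unfolding computable_def by blast
  \<comment> \<open>The step function of \<open>PrimRec\<close> receives the counter first and the
    previous value second.\<close>
  let ?g = "Comp f1 [Proj 1]"
  have "rec_eval (PrimRec f2 ?g) [m, n] ((g ^^ m) (h n))" for m n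
  proof (induction m)
    case 0
    then show ?case using f(2) by (auto intro: eval_PrimRec_0)
  next
    case (Suc m)
    have "rec_eval (Proj 1) [m, (g ^^ m) (h n), n] ((g ^^ m) (h n))"
      using eval_Proj[of 1 "[m, (g ^^ m) (h n), n]"] by simp
    then have "rec_eval ?g [m, (g ^^ m) (h n), n] ((g ^^ Suc m) (h n))"
      using f(1) by (intro eval_Comp[where ys = "[(g ^^ m) (h n)]"]) auto
    with Suc show ?case by (rule eval_PrimRec_Suc)
  qed
  moreover have "rec_eval (Proj 0) [n] n" for n using eval_Proj[of 0 "[n]"] by simp
  ultimately have "rec_eval (Comp (PrimRec f2 ?g) [f3, Proj 0]) [n] ((g ^^ l n) (h n))" for n
    using f(3) by (intro eval_Comp[where ys = "[l n, n]"]) auto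
  then show ?thesis unfolding computable_def by blast
qed

lemma computable_add:
  assumes "computable g" "computable h"
  shows "computable (\<lambda>n. g n + h n)"
proof -
  have "(Suc ^^ m) n = m + n" for m n by (induction m) auto
  with computable_iterate[OF computable_Suc assms(2,1)] show ?thesis by simp
qed

lemma computable_mult_const: "computable (\<lambda>n. c * n)"
proof -
  have "((\<lambda>m. c + m) ^^ n) 0 = c * n" for n by (induction n) auto
  with computable_iterate[OF computable_add[OF computable_const computable_id] computable_const computable_id, of c 0]
  show ?thesis by simp
qed

text \<open>\<open>prod_encode\<close>, and with it \<open>list_encode\<close>, is built on triangle
  numbers. The auxiliary sum \<open>Suc m + n\<close> is the step function of their
  recursion.\<close>

lemma computable_triangle: "computable triangle"
proof -
  have add: "\<exists>f. \<forall>m n. rec_eval f [m, n] (Suc m + n)"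
  proof (intro exI allI)
    fix m n
    show "rec_eval (PrimRec Succ (Comp Succ [Proj 1])) [m, n] (Suc m + n)"
    proof (induction m)
      case 0
      then show ?case using eval_Succ by (auto intro: eval_PrimRec_0)
    next
      case (Suc m)
      have "rec_eval (Proj 1) [m, Suc m + n, n] (Suc m + n)"
        using eval_Proj[of 1 "[m, Suc m + n, n]"] by simp
      then have "rec_eval (Comp Succ [Proj 1]) [m, Suc m + n, n] (Suc (Suc m + n))"
        using eval_Succ by (intro eval_Comp[where ys = "[Suc m + n]"]) auto
      with eval_PrimRec_Suc[OF Suc] show ?case by simp
    qed
  qed
  then obtain f where f: "\<And>m n. rec_eval f [m, n] (Suc m + n)" by blast
  have "rec_eval (PrimRec Zero f) [n] (triangle n)" for n
  proof (induction n)
    case 0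
    then show ?case using eval_Zero by (auto intro: eval_PrimRec_0)
  next
    case (Suc n)
    from eval_PrimRec_Suc[OF this f] show ?case by (simp add: add.commute)
  qed
  then show ?thesis unfolding computable_def by blast
qed

lemma computable_list_encode_Cons:
  assumes "computable h"
  shows "computable (\<lambda>n. Suc (prod_encode (c, h n)))"
  unfolding prod_encode_def
  using computable_comp[OF computable_Suc computable_add[OF computable_comp[OF computable_triangle
    computable_add[OF computable_const assms]] computable_const, of c c]]
  by simp

lemma computable_append_const:
  assumes "computable (\<lambda>n. list_encode (ws n))"
  shows "computable (\<lambda>n. list_encode (vs @ ws n))"
  using assms
proof (induction vs)
  case (Cons v vs)
  then show ?case using computable_list_encode_Cons[of "\<lambda>n. list_encode (vs @ ws n)" v] by simp
qed simp

lemma computable_append_replicate: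
  assumes "computable (\<lambda>n. list_encode (ws n))" "computable l"
  shows "computable (\<lambda>n. list_encode (replicate (l n) c @ ws n))"
proof -
  have "((\<lambda>m. Suc (prod_encode (c, m))) ^^ l) (list_encode w) = list_encode (replicate l c @ w)" for l w
    by (induction l) simp_all
  with computable_iterate[OF computable_list_encode_Cons[OF computable_id] assms, of c]
  show ?thesis by simp
qed

text \<open>The diagonal argument, separated from group theory: the procedure composed with
  \<open>w\<close> has an index \<open>c\<close>, and its answer at \<open>c\<close> forces the
  opposite of what it claims about \<open>P c\<close>.\<close>

lemma no_decision_procedure:
  assumes "computable w"
    and index: "\<And>f. \<exists>c. \<forall>y. rec_eval f [c] y \<longrightarrow> (y = 0 \<longrightarrow> P c) \<and> (y = 1 \<longrightarrow> \<not> P c)"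
  shows "\<not> (\<forall>n. rec_eval d [w n] (if P n then 1 else 0))"
proof
  assume d: "\<forall>n. rec_eval d [w n] (if P n then 1 else 0)"
  obtain f where f: "\<And>n. rec_eval f [n] (w n)" using assms(1) unfolding computable_def by blast
  have run: "rec_eval (Comp d [f]) [n] (if P n then 1 else 0)" for n
    using f d by (intro eval_Comp[where ys = "[w n]"]) auto
  obtain c where "\<forall>y. rec_eval (Comp d [f]) [c] y \<longrightarrow> (y = 0 \<longrightarrow> P c) \<and> (y = 1 \<longrightarrow> \<not> P c)"
    using index by blast
  with run[of c] show False by (cases "P c") auto
qed

section \<open>Undecidability\<close>

text \<open>Base 7 holds the tokens \<open>1\<close> to \<open>6\<close> and the mark 0 of an empty
  stack.\<close>

interpretation SM: stack_machine 7 6 interpreter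
  by standard simp_all

lemma set_keep: "x < 7 \<Longrightarrow> set (keep x) \<subseteq> {..<7}"
  by (simp add: keep_def)

text \<open>This is what preserves \<open>stacks_ok\<close>: entries stay digits, and the state
  stays a single nonzero digit.\<close>

lemma rule_shape:
  assumes "interpreter ts = Some ps" "\<forall>t\<in>set ts. t < 7"
  shows "length ps = 6 \<and> (\<forall>p\<in>set ps. set p \<subseteq> {..<7}) \<and> (\<exists>q>0. ps ! 0 = [q])"
proof -
  obtain q a b d x y where ts: "ts = [q, a, b, d, x, y]"
    using assms(1) by (cases ts rule: interpreter.cases) simp_all
  define small where "small w \<longleftrightarrow> set w \<subseteq> {..<7}" for w :: "nat list"
  have small: "small []" "\<And>t w. small (t # w) \<longleftrightarrow> t < 7 \<and> small w" "a < 7" "b < 7"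
    "small (keep a)" "small (keep b)" "small (keep d)" "small (keep x)" "small (keep y)"
    using assms(2) ts set_keep by (simp_all add: small_def)
  have "length ps = 6 \<and> (\<forall>p\<in>set ps. small p) \<and> (\<exists>q>0. ps ! 0 = [q])"
    using assms(1) unfolding ts interpreter.simps
    by (simp split: if_split_asm; hypsubst; simp add: small)
  then show ?thesis by (simp add: small_def)
qed

lemma top_less: "set s \<subseteq> {..<7} \<Longrightarrow> top_digit s < 7"
  by (cases s) auto

lemma stacks_ok_update:
  assumes "SM.stacks_ok ss" "interpreter (map top_digit ss) = Some ps"
  shows "length ps = 6" "SM.stacks_ok (update ps ss)"
proof -
  have ss: "length ss = 6" "\<And>s. s \<in> set ss \<Longrightarrow> set s \<subseteq> {..<7}" "\<exists>q>0. ss ! 0 = [q]"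
    using assms(1) by (auto simp: SM.stacks_ok_def)
  then have ps: "length ps = 6" "\<And>p. p \<in> set ps \<Longrightarrow> set p \<subseteq> {..<7}" "\<exists>q>0. ps ! 0 = [q]"
    using rule_shape[OF assms(2)] top_less by auto
  then show "length ps = 6" by simp
  have "set (p @ tl s) \<subseteq> {..<7}" if "(p, s) \<in> set (zip ps ss)" for p s
  proof -
    have "set p \<subseteq> {..<7}" "set s \<subseteq> {..<7}"
      using that ps(2) ss(2) by (blast dest: set_zip_leftD set_zip_rightD)+
    moreover have "set (tl s) \<subseteq> set s" by (cases s) auto
    ultimately show ?thesis by simp
  qed
  then show "SM.stacks_ok (update ps ss)"
    using ss ps unfolding SM.stacks_ok_def update_def by fastforce
qed

lemma reach_finite_order:
  assumes "reach ss ts" "SM.stacks_ok ss"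
  shows "SM.stacks_ok ts \<and>
    (SM.has_finite_order (map SM.digits ss) \<longleftrightarrow> SM.has_finite_order (map SM.digits ts))"
  using assms
proof (induction rule: rtranclp_induct)
  case (step ts us)
  then obtain ps where ps: "interpreter (map top_digit ts) = Some ps" "us = update ps ts"
    by (auto simp: machine_step_def)
  with step stacks_ok_update SM.has_finite_order_update show ?case by blast
qed simp

text \<open>The third counter is the program and the last one its input; \<open>n\<close> serves as
  both.\<close>

definition start :: "nat \<Rightarrow> nat list" where
  "start n = [1, 0, n, 0, 0, SM.digits (block n)]"

lemma start_index:
  "\<exists>c. \<forall>y. rec_eval f [c] y \<longrightarrow>
     (y = 0 \<longrightarrow> SM.has_finite_order (start c)) \<and> (y = 1 \<longrightarrow> \<not> SM.has_finite_order (start c))"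
proof (intro exI allI impI)
  let ?c = "SM.digits (program f)"
  fix y assume "rec_eval f [?c] y"
  from machine_correct[OF this] obtain ss where ss:
    "reach [[1], [], program f, [], [], block ?c] ss"
    "if y = 0 then machine_step ss = None else interpreter (map top_digit ss) \<noteq> None \<and> machine_step ss = Some ss"
    by blast
  have "set (program f) \<subseteq> {..<7}" using set_code by (fastforce simp: program_def)
  then have "SM.stacks_ok [[1], [], program f, [], [], block ?c]"
    by (auto simp: SM.stacks_ok_def block_def)
  from reach_finite_order[OF ss(1) this] have ok: "SM.stacks_ok ss"
    and fin: "SM.has_finite_order (start ?c) \<longleftrightarrow> SM.has_finite_order (map SM.digits ss)"
    by (simp_all add: start_def)
  have "SM.has_finite_order (start ?c)" if "y = 0"
    using ss(2) that fin SM.finite_order_halting[OF ok] by (simp add: machine_step_def)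
  moreover have "\<not> SM.has_finite_order (start ?c)" if y: "y = 1"
  proof -
    obtain ps where "interpreter (map top_digit ss) = Some ps" "update ps ss = ss"
      using ss(2) y by (auto simp: machine_step_def)
    with SM.infinite_order_fixed[OF ok] stacks_ok_update(1)[OF ok] fin show ?thesis by simp
  qed
  ultimately show "(y = 0 \<longrightarrow> SM.has_finite_order (start ?c)) \<and> (y = 1 \<longrightarrow> \<not> SM.has_finite_order (start ?c))"
    by blast
qed

lemma config_word_start:
  "SM.config_word (start n) =
     [GT 0] @ replicate n (GT 2) @ replicate (SM.digits (block n)) (GT 5) @ [GU] @
     replicate (SM.digits (block n)) (GTi 5) @ replicate n (GTi 2) @ [GTi 0, GS]"
proof -
  have "[0..<6] = [0, 1, 2, 3, 4, 5 :: nat]" by (simp add: upt_rec)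
  then show ?thesis by (simp add: SM.config_word_def start_def)
qed

text \<open>Only finitely many values of \<open>h\<close> enter, as constants, so any numbering of
  the generators is allowed.\<close>

lemma computable_start_word:
  "computable (\<lambda>n. list_encode (map h (SM.config_word (start n))))"
proof -
  \<comment> \<open>Horner's rule: the closing entry gives 2, and each one in front maps
    \<open>m\<close> to \<open>1 + 7 * m\<close>.\<close>
  have "SM.digits (block n) = ((\<lambda>m. 1 + 7 * m) ^^ n) 2" for n
    by (induction n) (simp_all add: block_def)
  then have "computable (\<lambda>n. SM.digits (block n))"
    using computable_iterate[OF computable_add[OF computable_const computable_mult_const] computable_const computable_id, of 1 7 2]
    by simp
  then show ?thesis
    unfolding config_word_start map_append map_replicate
    by (intro computable_append_const computable_append_replicate computable_id computable_const)
qed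

theorem theorem1p1:
  shows "\<exists>(G :: (nat list \<Rightarrow> nat list) monoid) S.
           automaton_group G \<and>
           finite S \<and> S \<subseteq> carrier G \<and> generate G S = carrier G \<and>
           (\<forall>s\<in>S. inv\<^bsub>G\<^esub> s \<in> S) \<and>
           \<not> order_problem_decidable G S"
proof (intro exI conjI ballI)
  let ?M = "encode_mealy SM.M"
  let ?G = "generated_group ?M" and ?S = "state_maps ?M"
  show "automaton_group ?G" by (rule SM.automaton_group_M)
  show "finite ?S" by (rule SM.finite_state_maps_M)
  show "?S \<subseteq> carrier ?G" by (auto simp: generated_group_def intro: generate.incl)
  show "generate ?G ?S = carrier ?G"
    by (rule generate_state_maps[OF invertible_automaton_encode_mealy[OF SM.invertible_automaton_M]])
  show "inv\<^bsub>?G\<^esub> s \<in> ?S" if "s \<in> ?S" for s using that by (rule SM.state_maps_M_inv)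
  show "\<not> order_problem_decidable ?G ?S"
  proof
    assume "order_problem_decidable ?G ?S"
    then obtain e d where d: "\<And>w. w \<in> lists ?S \<Longrightarrow>
        rec_eval d [list_encode (map e w)] (if finite_order ?G (word_value ?G w) then 1 else 0)"
      unfolding order_problem_decidable_def decidable_language_def by fastforce
    have "map SM.gen_map (SM.config_word (start n)) \<in> lists ?S" for n
      using SM.config_word_states[of "start n"] by (auto simp: SM.state_maps_M)
    \<comment> \<open>The numbering of the generators composed with \<open>gen_map\<close> is the
      \<open>h\<close> of \<open>computable_start_word\<close>.\<close>
    from d[OF this] have "rec_eval d [list_encode (map (e \<circ> SM.gen_map) (SM.config_word (start n)))]
        (if SM.has_finite_order (start n) then 1 else 0)" for n
      by (simp add: SM.finite_order_config_word)
    with no_decision_procedure[OF computable_start_word start_index] show False by blast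
  qed
qed

end
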